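(* Let $f(t)$ be the characteristic function of some non-degenerate real random variable. Suppose that $f(t)$ is analytic in the disk $|t|<r$ for some $r>0$, with power series expansion $f(t)=\sum_{k=0}^{\infty}a_k t^k$ there. If the set $\mathfrak{M}=\{\mu_k/k! : k=0,1,2,\ldots\}$ is finite, then $f$ has one of the following forms: either $$f(t)=\frac{1+ iat}{1+ it}\quad\text{or}\quad f(t)=\frac{1- iat}{1- it},\qquad \text{for some real } a \text{ with } 0\le a\le 1,$$ or $$f(t)=\frac{1+iat+bt^2}{1+t^2},\qquad \text{for some real } a,b \text{ with } b\ge 0,\ \frac{1-a-b}{2}\ge 0,\ \frac{1+a-b}{2}\ge 0.$$ Conversely, if $f$ has one of these forms, then the set $\mathfrak{M}$ is finite.
   Context: For a real random variable $X$, its characteristic function is $f(t)=\mathbb{E}[e^{itX}]$, $t\in\mathbb{R}$. Saying that $f$ is analytic in the disk $|t|<r$ means that $f$ coincides on the real interval $(-r,r)$ with a function analytic in the complex disk $|t|<r$; then all moments $\mu_k=\mathbb{E}[X^k]$ exist and $a_k=i^k\mu_k/k!$. The set $\mathfrak{M}$ is the set of different values of the fractions $\mu_k/k!$, $k=0,1,2,\ldots$. A random variable is degenerate if it is almost surely constant, and non-degenerate otherwise. *)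

theory Defs
  imports "HOL-Probability.Probability"
begin

definition degenerate_rv :: "'a measure \<Rightarrow> ('a \<Rightarrow> real) \<Rightarrow> bool" where
  "degenerate_rv M X \<longleftrightarrow> (\<exists>c. AE x in M. X x = c)"

definition char_fun :: "'a measure \<Rightarrow> ('a \<Rightarrow> real) \<Rightarrow> real \<Rightarrow> complex" where
  "char_fun M X = char (distr M borel X)"

definition moment :: "'a measure \<Rightarrow> ('a \<Rightarrow> real) \<Rightarrow> nat \<Rightarrow> real" where
  "moment M X k = prob_space.expectation M (\<lambda>x. X x ^ k)"

definition moment_ratios :: "'a measure \<Rightarrow> ('a \<Rightarrow> real) \<Rightarrow> real set" where
  "moment_ratios M X = {moment M X k / fact k | k. True}"

text \<open>A function of a real variable is analytic in the complex disk of radius \<open>r\<close>, with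
  coefficients \<open>c\<close>, if on \<open>(-r, r)\<close> it coincides with a function \<open>F\<close> that is analytic in the disk
  and has the power series with coefficients \<open>c\<close> there.\<close>

definition analytic_in_disk :: "(real \<Rightarrow> complex) \<Rightarrow> real \<Rightarrow> (nat \<Rightarrow> complex) \<Rightarrow> bool" where
  "analytic_in_disk f r c \<longleftrightarrow>
     (\<exists>F. F analytic_on ball 0 r \<and>
          (\<forall>z\<in>ball 0 r. (\<lambda>k. c k * z ^ k) sums F z) \<and>
          (\<forall>t. \<bar>t\<bar> < r \<longrightarrow> F (of_real t) = f t))"

definition has_listed_form :: "(real \<Rightarrow> complex) \<Rightarrow> bool" where
  "has_listed_form f \<longleftrightarrow>
     (\<exists>a::real. 0 \<le> a \<and> a \<le> 1 \<and>
        ((\<forall>t. f t = (1 + \<i> * of_real a * of_real t) / (1 + \<i> * of_real t)) \<or>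
         (\<forall>t. f t = (1 - \<i> * of_real a * of_real t) / (1 - \<i> * of_real t)))) \<or>
     (\<exists>a b::real. b \<ge> 0 \<and> (1 - a - b) / 2 \<ge> 0 \<and> (1 + a - b) / 2 \<ge> 0 \<and>
        (\<forall>t. f t = (1 + \<i> * of_real a * of_real t + of_real b * of_real t ^ 2)
                    / (1 + of_real t ^ 2)))"

end

theory Submission
  imports Defs
    "HOL-Complex_Analysis.Conformal_Mappings"
    "HOL-Computational_Algebra.Fundamental_Theorem_Algebra"
    "HOL-Real_Asymp.Real_Asymp"
begin

text \<open>
  All three families of functions are special cases of
  \<open>b + p / (1 - i t) + q / (1 + i t)\<close>, the characteristic function of a mixture of the point
  mass at 0, the standard exponential law and its reflection; its moment ratios
  \<open>\<mu>\<^sub>k / k!\<close> are \<open>p + (-1)^k q\<close> for \<open>k \<ge> 1\<close>. Write \<open>m\<^sub>k\<close> for the moment ratios of the given law.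
  The proof shows that finitely many values force \<open>m\<^sub>k\<close> to be eventually of this form, and that
  the eventual behaviour of the moments determines the whole characteristic function. It uses
  positivity of moments rather than a theorem on power series with finitely many coefficients.

  Even indices: Cauchy-Schwarz makes the even moments log-convex, so the ratio of successive even
  \<open>m\<^sub>k\<close> is nondecreasing up to a factor tending to 1. The ratio takes finitely many values, hence it
  is eventually constant, and a geometric sequence with finitely many values is constant. So the
  even ratios are eventually a constant \<open>A > 0\<close>.

  Odd indices: under the weight \<open>\<bar>x\<bar>^n\<close>, normalised by \<open>n!\<close>, most of the mass sits
  near \<open>\<bar>x\<bar> = n\<close>, so \<open>x^2 / ((n + 1) (n + 2))\<close> is close to 1 there. A second use of
  Cauchy-Schwarz, which involves only even moments of high order, turns this into
  \<open>m\<^sub>n\<^sub>+\<^sub>2 - m\<^sub>n \<longlonglongrightarrow> 0\<close>, and so the odd ratios are eventually a constant \<open>B\<close>, with \<open>\<bar>B\<bar> \<le> A\<close>. Then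
  \<open>p = (A + B) / 2\<close> and \<open>q = (A - B) / 2\<close> are nonnegative
  (\<open>moment_ratios_eventually_periodic\<close>).

  Near 0 the characteristic function is therefore a polynomial plus
  \<open>p / (1 - i t) + q / (1 + i t)\<close>. Bounded moment ratios give a convergent power series of radius 1
  around every real point, so this identity propagates to the whole real line
  (\<open>char_eq_of_germ\<close>). A characteristic function is bounded, hence the polynomial is a constant
  \<open>b\<close>; and \<open>b\<close>, being the limit at infinity of a positive definite function, is nonnegative
  (\<open>char_limit_at_infinity_nonneg\<close>).

  Both directions rest on the fact that analyticity at 0 yields integrability of all powers and
  identifies the coefficients with the moments (\<open>moments_of_analytic_char\<close>).
\<close>

section \<open>Moments of a law with analytic characteristic function\<close>

text \<open>
  This is the vanishing of the \<open>m\<close>-th finite difference of a polynomial of degree below \<open>m\<close>. The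
  induction on the exponent splits off one factor \<open>x - j\<close> and absorbs \<open>j\<close> into the binomial
  coefficient.
\<close>

lemma alternating_binomial_power_sum:
  fixes x :: "'a::comm_ring_1"
  assumes "k < m"
  shows "(\<Sum>j\<le>m. (-1) ^ j * of_nat (m choose j) * (x - of_nat j) ^ k) = 0"
  using assms
proof (induction k arbitrary: m x)
  case 0
  then show ?case by (simp add: choose_alternating_sum)
next
  case (Suc k)
  then obtain n where m: "m = Suc n" and kn: "k < n" by (cases m) auto
  let ?g = "\<lambda>j. (-1) ^ j * of_nat (m choose j) * (x - of_nat j) ^ k :: 'a"
  have "(\<Sum>j\<le>m. of_nat j * ?g j) = (\<Sum>j\<le>n. of_nat (Suc j) * ?g (Suc j))"
    unfolding m by (subst sum.atMost_Suc_shift) simp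
  also have "\<dots> = (\<Sum>j\<le>n. - of_nat m * ((-1) ^ j * of_nat (n choose j) * (x - 1 - of_nat j) ^ k))"
  proof (rule sum.cong[OF refl])
    fix j
    have "of_nat (Suc j) * ?g (Suc j)
        = (-1) ^ Suc j * of_nat (Suc j * (m choose Suc j)) * (x - of_nat (Suc j)) ^ k"
      by (simp only: of_nat_mult mult_ac)
    also have "Suc j * (m choose Suc j) = m * (n choose j)"
      unfolding m by (rule Suc_times_binomial)
    finally show "of_nat (Suc j) * ?g (Suc j)
        = - of_nat m * ((-1) ^ j * of_nat (n choose j) * (x - 1 - of_nat j) ^ k)"
      by (simp add: mult_ac diff_diff_eq)
  qed
  also have "\<dots> = 0"
    unfolding sum_distrib_left[symmetric] using Suc.IH[OF kn, of "x - 1"] by simp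
  finally have "(\<Sum>j\<le>m. of_nat j * ?g j) = 0" .
  moreover have "(\<Sum>j\<le>m. ?g j) = 0" using Suc.IH Suc.prems by simp
  moreover have "(\<Sum>j\<le>m. (-1) ^ j * of_nat (m choose j) * (x - of_nat j) ^ Suc k)
     = x * (\<Sum>j\<le>m. ?g j) - (\<Sum>j\<le>m. of_nat j * ?g j)"
    by (simp add: sum_distrib_left sum_subtractf[symmetric] algebra_simps)
  ultimately show ?case by simp
qed

text \<open>
  Used twice: it bounds high central differences of a characteristic function, and it bounds Taylor
  remainders when coefficients are compared.
\<close>

lemma power_series_vanishing_order_bound:
  fixes a :: "nat \<Rightarrow> complex"
  assumes r: "0 < r" and sums: "\<And>z. norm z < r \<Longrightarrow> (\<lambda>k. a k * z ^ k) sums D z"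
    and zero: "\<And>k. k < m \<Longrightarrow> a k = 0"
  obtains C where "0 \<le> C" "\<And>z. norm z \<le> r / 2 \<Longrightarrow> norm (D z) \<le> C * norm z ^ m"
proof -
  define s where "s = r / 2"
  have "0 < s" using r by (simp add: s_def)
  have abs_summable: "summable (\<lambda>k. norm (a k * of_real s ^ k))"
    using powser_insidea[of a "of_real (3 * r / 4)" "of_real s"] sums[of "of_real (3 * r / 4)"] r
    by (simp add: sums_iff s_def)
  define C where "C = (\<Sum>k. norm (a (k + m) * of_real s ^ (k + m))) / s ^ m"
  have sC: "summable (\<lambda>k. norm (a (k + m) * of_real s ^ (k + m)))"
    using abs_summable by (rule summable_ignore_initial_segment)
  have norm_shift: "norm (a (k + m) * of_real s ^ (k + m)) = norm (a (k + m)) * s ^ k * s ^ m" for k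
    using \<open>0 < s\<close> by (simp add: norm_mult norm_power power_add)
  have sC': "summable (\<lambda>k. norm (a (k + m)) * s ^ k)"
    using summable_divide[OF sC, of "s ^ m"] \<open>0 < s\<close> by (simp add: norm_shift)
  have C_eq: "C = (\<Sum>k. norm (a (k + m)) * s ^ k)"
    unfolding C_def using suminf_divide[OF sC, of "s ^ m"] \<open>0 < s\<close> by (simp add: norm_shift)
  have "norm (D z) \<le> C * norm z ^ m" if z: "norm z \<le> s" for z
  proof -
    have bd: "norm (a (k + m) * z ^ k) \<le> norm (a (k + m)) * s ^ k" for k
      using z by (auto simp: norm_mult norm_power intro!: mult_left_mono power_mono)
    have S: "summable (\<lambda>k. norm (a (k + m) * z ^ k))"
      by (rule summable_comparison_test'[OF sC', of 0]) (use bd in simp)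
    have "norm z < r" using z r by (simp add: s_def)
    from sums[OF this] have "(\<lambda>k. a (k + m) * z ^ (k + m)) sums (D z - (\<Sum>k<m. a k * z ^ k))"
      by (rule sums_split_initial_segment)
    then have "(\<lambda>k. z ^ m * (a (k + m) * z ^ k)) sums D z"
      by (simp add: zero power_add mult_ac)
    then have "D z = z ^ m * (\<Sum>k. a (k + m) * z ^ k)"
      using suminf_mult[OF summable_norm_cancel[OF S], of "z ^ m"] by (simp add: sums_iff)
    then have "norm (D z) = norm (\<Sum>k. a (k + m) * z ^ k) * norm z ^ m"
      by (simp add: norm_mult norm_power)
    moreover have "norm (\<Sum>k. a (k + m) * z ^ k) \<le> C"
      unfolding C_eq using summable_norm[OF S] suminf_le[OF bd S sC'] by (rule order_trans)
    ultimately show ?thesis by (simp only: mult_right_mono zero_le_power norm_ge_zero)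
  qed
  moreover have "0 \<le> C"
    unfolding C_eq using \<open>0 < s\<close> by (intro suminf_nonneg sC') auto
  ultimately show ?thesis using that by (auto simp: s_def)
qed

text \<open>
  Up to sign, the integral is the central difference of order \<open>2 n\<close> and step \<open>2 h\<close> of the
  characteristic function at 0: expand \<open>(exp (i h x) - exp (- i h x))^(2 n)\<close> by the binomial theorem.
\<close>

lemma (in real_distribution) central_difference_char:
  "complex_of_real (\<integral>x. (2 * sin (h * x)) ^ (2 * n) \<partial>M)
    = (-1) ^ n * (\<Sum>j\<le>2*n. (-1) ^ j * of_nat (2 * n choose j) * char M (2 * h * (real n - real j)))"
proof -
  have pointwise: "complex_of_real ((2 * sin (h * x)) ^ (2 * n))
     = (-1) ^ n * (\<Sum>j\<le>2*n. (-1) ^ j * of_nat (2 * n choose j) * iexp (2 * h * (real n - real j) * x))" for x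
  proof -
    let ?w = "iexp (h * x)" and ?v = "iexp (- (h * x))"
    have 1: "2 * \<i> * complex_of_real (sin (h * x)) = - ?v + ?w"
      by (simp add: complex_eq_iff Re_exp Im_exp)
    have "(2 * \<i> * complex_of_real (sin (h * x))) ^ (2 * n)
        = (\<Sum>j\<le>2*n. of_nat (2 * n choose j) * (- ?v) ^ j * ?w ^ (2 * n - j))"
      unfolding 1 by (rule binomial_ring)
    also have "\<dots> = (\<Sum>j\<le>2*n. (-1) ^ j * of_nat (2 * n choose j) * iexp (2 * h * (real n - real j) * x))"
    proof (rule sum.cong[OF refl])
      fix j assume "j \<in> {..2*n}"
      then have j: "(of_nat (2 * n - j) :: complex) = 2 * of_nat n - of_nat j" by (simp add: of_nat_diff)
      have "?v ^ j * ?w ^ (2 * n - j) = exp (of_nat j * (\<i> * complex_of_real (- (h * x))) + of_nat (2 * n - j) * (\<i> * complex_of_real (h * x)))"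
        by (simp only: exp_add exp_of_nat_mult)
      also have "of_nat j * (\<i> * complex_of_real (- (h * x))) + of_nat (2 * n - j) * (\<i> * complex_of_real (h * x))
          = \<i> * complex_of_real (2 * h * (real n - real j) * x)"
        unfolding j by (simp add: algebra_simps)
      finally show "of_nat (2 * n choose j) * (- ?v) ^ j * ?w ^ (2 * n - j)
          = (-1) ^ j * of_nat (2 * n choose j) * iexp (2 * h * (real n - real j) * x)"
        by (subst power_minus) (simp only: mult_ac)
    qed
    finally have "(2 * \<i> * complex_of_real (sin (h * x))) ^ (2 * n) = \<dots>" .
    moreover have "(2 * \<i> * complex_of_real (sin (h * x))) ^ (2 * n)
        = (-1) ^ n * complex_of_real ((2 * sin (h * x)) ^ (2 * n))"
    proof -
      have "(2 * \<i> * complex_of_real (sin (h * x)))\<^sup>2 = (-1) * complex_of_real ((2 * sin (h * x))\<^sup>2)"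
        by (simp add: power_mult_distrib)
      then have "(2 * \<i> * complex_of_real (sin (h * x))) ^ (2 * n)
          = ((-1) * complex_of_real ((2 * sin (h * x))\<^sup>2)) ^ n"
        by (simp only: power_mult)
      also have "\<dots> = (-1) ^ n * complex_of_real ((2 * sin (h * x)) ^ (2 * n))"
        by (simp only: power_mult_distrib[of "-1"] power_mult of_real_power)
      finally show ?thesis .
    qed
    ultimately show ?thesis
      by (metis (no_types, lifting) left_minus_one_mult_self)
  qed
  have int: "integrable M (\<lambda>x. iexp (u * x))" for u
    by (intro integrable_iexp) auto
  have "complex_of_real (\<integral>x. (2 * sin (h * x)) ^ (2 * n) \<partial>M)
      = (CLINT x|M. complex_of_real ((2 * sin (h * x)) ^ (2 * n)))"
    by (rule integral_complex_of_real[symmetric])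
  also have "\<dots> = (-1) ^ n * (\<Sum>j\<le>2*n. (-1) ^ j * of_nat (2 * n choose j) * char M (2 * h * (real n - real j)))"
    unfolding pointwise char_def using int
    by (simp add: Bochner_Integration.integral_sum del: of_real_mult of_real_diff)
  finally show ?thesis .
qed

text \<open>
  Divided by \<open>(2 h)^(2 n)\<close>, the central difference of order \<open>2 n\<close> stays bounded as \<open>h \<longlongrightarrow> 0\<close>,
  because all coefficients of order below \<open>2 n\<close> cancel from it. On the other side the integrand
  \<open>(sin (h x) / h)^(2 n)\<close> tends to \<open>x^(2 n)\<close>, and Fatou's lemma gives a finite moment.
\<close>

lemma (in real_distribution) even_moment_of_power_series:
  assumes r: "0 < r" and sums: "\<And>z. norm z < r \<Longrightarrow> (\<lambda>k. c k * z ^ k) sums F z"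
    and F: "\<And>t. \<bar>t\<bar> < r \<Longrightarrow> F (of_real t) = char M t"
  shows "integrable M (\<lambda>x. x ^ (2 * n))"
proof -
  define T where "T k = (\<Sum>j\<le>2*n. (-1) ^ j * of_nat (2 * n choose j) * (of_nat n - of_nat j) ^ k :: complex)" for k
  define D where "D z = (\<Sum>j\<le>2*n. (-1) ^ j * of_nat (2 * n choose j) * F (2 * z * (of_nat n - of_nat j)))" for z
  \<comment> \<open>The sample points are at most \<open>2 n\<close> times the step away from 0 and have to stay inside the disk.\<close>
  define \<rho> where "\<rho> = r / (2 * n + 1)"
  have \<rho>: "0 < \<rho>" using r by (simp add: \<rho>_def)
  have inside: "\<bar>2 * u * (real n - real j)\<bar> < r" if "\<bar>u\<bar> < \<rho>" "j \<le> 2 * n" for u j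
  proof -
    have "\<bar>real n - real j\<bar> \<le> n" using that(2) by linarith
    then have "\<bar>2 * u * (real n - real j)\<bar> \<le> \<bar>u\<bar> * (2 * n)"
      by (simp add: abs_mult mult_left_mono)
    also have "\<dots> \<le> \<bar>u\<bar> * (2 * n + 1)" by (intro mult_left_mono) auto
    also have "\<dots> < r" using that(1) by (simp add: \<rho>_def field_simps)
    finally show ?thesis .
  qed
  have Dsums: "(\<lambda>k. (c k * 2 ^ k * T k) * z ^ k) sums D z" if "norm z < \<rho>" for z
  proof -
    have "(\<lambda>k. \<Sum>j\<le>2*n. (-1) ^ j * of_nat (2 * n choose j) * (c k * (2 * z * (of_nat n - of_nat j)) ^ k)) sums D z"
      unfolding D_def
    proof (intro sums_sum sums_mult sums)
      fix j assume "j \<in> {..2*n}"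
      then have "\<bar>2 * norm z * (real n - real j)\<bar> < r"
        using inside[of "norm z" j] that by simp
      moreover have "norm (of_nat n - of_nat j :: complex) = \<bar>real n - real j\<bar>"
        by (metis norm_of_real of_real_diff of_real_of_nat_eq)
      ultimately show "norm (2 * z * (of_nat n - of_nat j)) < r"
        by (simp add: norm_mult abs_mult)
    qed
    moreover have "(\<Sum>j\<le>2*n. (-1) ^ j * of_nat (2 * n choose j) * (c k * (2 * z * (of_nat n - of_nat j)) ^ k))
        = (c k * 2 ^ k * T k) * z ^ k" for k
      unfolding T_def sum_distrib_left sum_distrib_right power_mult_distrib
      by (intro sum.cong refl) (simp only: mult_ac)
    ultimately show ?thesis by simp
  qed
  have "c k * 2 ^ k * T k = 0" if "k < 2 * n" for k
    unfolding T_def using alternating_binomial_power_sum[OF that, of "of_nat n :: complex"] by simp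
  from power_series_vanishing_order_bound[OF \<rho> Dsums this]
  obtain C where C: "0 \<le> C" "\<And>z. norm z \<le> \<rho> / 2 \<Longrightarrow> norm (D z) \<le> C * norm z ^ (2 * n)" by metis
  have bound: "(\<integral>x. (2 * sin (h * x)) ^ (2 * n) \<partial>M) \<le> C * h ^ (2 * n)" if h: "0 < h" "h \<le> \<rho> / 2" for h
  proof -
    have "D (of_real h) = (\<Sum>j\<le>2*n. (-1) ^ j * of_nat (2 * n choose j) * char M (2 * h * (real n - real j)))"
      unfolding D_def
    proof (intro sum.cong refl arg_cong2[where f = "(*)"])
      fix j assume "j \<in> {..2*n}"
      then have "\<bar>2 * h * (real n - real j)\<bar> < r" using h \<rho> by (intro inside) auto
      from F[OF this] show "F (2 * of_real h * (of_nat n - of_nat j)) = char M (2 * h * (real n - real j))"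
        by simp
    qed
    then have "norm (complex_of_real (\<integral>x. (2 * sin (h * x)) ^ (2 * n) \<partial>M)) = norm (D (of_real h))"
      unfolding central_difference_char by (simp add: norm_mult norm_power)
    moreover have "norm (D (of_real h)) \<le> C * h ^ (2 * n)"
      using C(2)[of "of_real h"] h by simp
    ultimately show ?thesis by (simp only: norm_of_real abs_le_iff)
  qed
  define h where "h m = (\<rho> / 2) / real (Suc m)" for m
  define g where "g m x = ((2 * sin (h m * x)) / (2 * h m)) ^ (2 * n)" for m x
  have h: "0 < h m" "h m \<le> \<rho> / 2" for m
    using \<rho> by (auto simp: h_def field_simps)
  have h0: "h \<longlonglongrightarrow> 0"
    unfolding h_def by (rule LIMSEQ_Suc) (rule lim_const_over_n)
  have g_nonneg: "0 \<le> g m x" for m x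
    unfolding g_def by (simp add: power_mult)
  have g_lim: "(\<lambda>m. g m x) \<longlonglongrightarrow> x ^ (2 * n)" for x
  proof -
    have "((\<lambda>y. sin (y * x) / y) \<longlongrightarrow> x) (at 0)"
    proof -
      have "((\<lambda>y. sin (y * x)) has_real_derivative x) (at 0)"
        by (auto intro!: derivative_eq_intros)
      then show ?thesis by (simp add: DERIV_def)
    qed
    moreover have "filterlim h (at 0) sequentially"
      using h0 h(1) by (auto simp: filterlim_at intro!: always_eventually less_imp_neq[THEN not_sym])
    ultimately have "(\<lambda>m. sin (h m * x) / h m) \<longlonglongrightarrow> x"
      by (rule filterlim_compose)
    then show ?thesis unfolding g_def by (auto intro: tendsto_power)
  qed
  have g_int: "integrable M (g m)" for m
  proof (rule integrable_const_bound)
    show "AE x in M. norm (g m x) \<le> (1 / h m) ^ (2 * n)"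
      using h(1)[of m] by (auto simp: g_def power_abs intro!: power_mono divide_right_mono)
  qed (unfold g_def, measurable)
  have nn: "(\<integral>\<^sup>+x. ennreal (g m x) \<partial>M) \<le> ennreal (C / 2 ^ (2 * n))" for m
  proof -
    have "(\<integral>\<^sup>+x. ennreal (g m x) \<partial>M) = ennreal (\<integral>x. g m x \<partial>M)"
      using g_nonneg by (intro nn_integral_eq_integral g_int) auto
    also have "(\<integral>x. g m x \<partial>M) = (\<integral>x. (2 * sin (h m * x)) ^ (2 * n) \<partial>M) / (2 * h m) ^ (2 * n)"
      unfolding g_def by (simp add: power_divide del: power_mult_distrib)
    also have "\<dots> \<le> (C * h m ^ (2 * n)) / (2 * h m) ^ (2 * n)"
      using bound[OF h(1) h(2), of m] h(1)[of m] by (intro divide_right_mono) auto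
    also have "\<dots> = C / 2 ^ (2 * n)" using h(1)[of m] by (simp add: power_mult_distrib)
    finally show ?thesis by (simp add: ennreal_leI)
  qed
  have "(\<integral>\<^sup>+x. ennreal (x ^ (2 * n)) \<partial>M) = (\<integral>\<^sup>+x. liminf (\<lambda>m. ennreal (g m x)) \<partial>M)"
    by (intro nn_integral_cong lim_imp_Liminf[symmetric] tendsto_ennrealI g_lim) auto
  also have "\<dots> \<le> liminf (\<lambda>m. \<integral>\<^sup>+x. ennreal (g m x) \<partial>M)"
    by (rule nn_integral_liminf) (simp add: g_def)
  also have "\<dots> \<le> liminf (\<lambda>m. ennreal (C / 2 ^ (2 * n)))"
    using nn by (intro Liminf_mono always_eventually) simp
  also have "\<dots> = ennreal (C / 2 ^ (2 * n))" by (simp add: Liminf_const)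
  finally have "(\<integral>\<^sup>+x. ennreal (x ^ (2 * n)) \<partial>M) < \<infinity>"
    by (rule le_less_trans) simp
  then show ?thesis
    by (intro integrableI_nonneg) (auto simp: power_mult)
qed

lemma (in prob_space) integrable_power_of_even:
  fixes X :: "'a \<Rightarrow> real"
  assumes [measurable]: "X \<in> borel_measurable M" and "\<And>n. integrable M (\<lambda>x. X x ^ (2 * n))"
  shows "integrable M (\<lambda>x. X x ^ k)"
proof (rule Bochner_Integration.integrable_bound)
  show "integrable M (\<lambda>x. 1 + X x ^ (2 * k))" using assms by simp
  have "norm (y ^ k) \<le> norm (1 + y ^ (2 * k))" for y :: real
  proof -
    have "2 * \<bar>y ^ k\<bar> \<le> 1 + (y ^ k)\<^sup>2"
      using zero_le_power2[of "\<bar>y ^ k\<bar> - 1"] by (simp add: power2_diff)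
    then show ?thesis by (simp add: power_mult[symmetric] mult.commute)
  qed
  then show "AE x in M. norm (X x ^ k) \<le> norm (1 + X x ^ (2 * k))" by simp
qed simp

text \<open>
  Both the power series and the moment expansion approximate the characteristic function to every
  order at 0, so the coefficients agree one after the other.
\<close>

lemma (in real_distribution) power_series_coeff_eq_moment:
  assumes r: "0 < r" and sums: "\<And>z. norm z < r \<Longrightarrow> (\<lambda>k. c k * z ^ k) sums F z"
    and F: "\<And>t. \<bar>t\<bar> < r \<Longrightarrow> F (of_real t) = char M t"
    and int: "\<And>k. integrable M (\<lambda>x. x ^ k)"
  shows "c k = \<i> ^ k * of_real (expectation (\<lambda>x. x ^ k) / fact k)"
proof (induction k rule: less_induct)
  case (less n)
  define \<mu> where "\<mu> k = \<i> ^ k * of_real (expectation (\<lambda>x. x ^ k) / fact k)" for k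
  define D where "D z = F z - (\<Sum>k\<le>n. c k * z ^ k)" for z
  have Dsums: "(\<lambda>k. (if k \<le> n then 0 else c k) * z ^ k) sums D z" if "norm z < r" for z
  proof -
    have "(\<lambda>k. if k \<in> {..n} then c k * z ^ k else 0) sums (\<Sum>k\<le>n. c k * z ^ k)"
      by (rule sums_If_finite_set) simp
    from sums_diff[OF sums[OF that] this] show ?thesis
      unfolding D_def by (rule sums_cong[THEN iffD1, rotated]) auto
  qed
  obtain C where C: "0 \<le> C" "\<And>z. norm z \<le> r / 2 \<Longrightarrow> norm (D z) \<le> C * norm z ^ Suc n"
    by (rule power_series_vanishing_order_bound[OF r Dsums, of "Suc n"]) (auto simp: less_Suc_eq_le)
  define B where "B = expectation (\<lambda>x. \<bar>x\<bar> ^ Suc n) / fact (Suc n)"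
  have absint: "integrable M (\<lambda>x. \<bar>x\<bar> ^ Suc n)"
    using integrable_abs[OF int[of "Suc n"]] by (simp only: power_abs)
  have approx: "norm (char M t - (\<Sum>k\<le>n. \<mu> k * of_real t ^ k)) \<le> B * \<bar>t\<bar> ^ Suc n" for t
  proof -
    let ?e = "expectation (\<lambda>x. min (2 * \<bar>x\<bar> ^ n * real (Suc n)) (\<bar>t\<bar> * \<bar>x\<bar> ^ Suc n))"
    have "(\<Sum>k\<le>n. \<mu> k * of_real t ^ k) = (\<Sum>k\<le>n. ((\<i> * t) ^ k / fact k) * expectation (\<lambda>x. x ^ k))"
      by (intro sum.cong refl) (simp add: \<mu>_def power_mult_distrib)
    then have "norm (char M t - (\<Sum>k\<le>n. \<mu> k * of_real t ^ k)) \<le> (\<bar>t\<bar> ^ n / fact (Suc n)) * ?e"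
      using char_approx2[of n t] int by simp
    also have "\<dots> \<le> (\<bar>t\<bar> ^ n / fact (Suc n)) * expectation (\<lambda>x. \<bar>t\<bar> * \<bar>x\<bar> ^ Suc n)"
      by (intro mult_left_mono integral_mono') (use absint in auto)
    also have "\<dots> = B * \<bar>t\<bar> ^ Suc n" by (simp add: B_def)
    finally show ?thesis .
  qed
  have key: "norm (c n - \<mu> n) \<le> (C + B) * t" if t: "0 < t" "t \<le> r / 2" for t
  proof -
    have "(\<Sum>k\<le>n. c k * of_real t ^ k) - (\<Sum>k\<le>n. \<mu> k * of_real t ^ k) = (c n - \<mu> n) * of_real t ^ n"
    proof -
      have "(\<Sum>k<n. c k * of_real t ^ k) = (\<Sum>k<n. \<mu> k * of_real t ^ k)"
        using less.IH by (intro sum.cong) (auto simp: \<mu>_def)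
      then show ?thesis by (simp add: lessThan_Suc_atMost[symmetric] algebra_simps)
    qed
    then have "(c n - \<mu> n) * of_real t ^ n = (char M t - (\<Sum>k\<le>n. \<mu> k * of_real t ^ k)) - D (of_real t)"
      using F[of t] t r by (simp add: D_def)
    then have "norm ((c n - \<mu> n) * of_real t ^ n)
        \<le> norm (char M t - (\<Sum>k\<le>n. \<mu> k * of_real t ^ k)) + norm (D (of_real t))"
      by (metis norm_triangle_ineq4)
    moreover have "norm (D (of_real t)) \<le> C * t ^ Suc n"
      using C(2)[of "of_real t"] t by simp
    moreover have "norm (char M t - (\<Sum>k\<le>n. \<mu> k * of_real t ^ k)) \<le> B * t ^ Suc n"
      using approx[of t] t by (simp only: abs_of_pos)
    ultimately have "norm ((c n - \<mu> n) * of_real t ^ n) \<le> B * t ^ Suc n + C * t ^ Suc n"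
      by linarith
    moreover have "norm ((c n - \<mu> n) * of_real t ^ n) = norm (c n - \<mu> n) * t ^ n"
      using t by (simp only: norm_mult norm_power norm_of_real abs_of_pos)
    ultimately have "norm (c n - \<mu> n) * t ^ n \<le> ((C + B) * t) * t ^ n"
      by (simp add: algebra_simps)
    then show ?thesis using t by simp
  qed
  have "norm (c n - \<mu> n) \<le> 0"
  proof (rule tendsto_lowerbound[of "\<lambda>t. (C + B) * t" _ "at_right 0"])
    show "((\<lambda>t. (C + B) * t) \<longlongrightarrow> 0) (at_right 0)"
      by (auto intro!: tendsto_eq_intros)
    have "eventually (\<lambda>t. t \<in> {0<..<r / 2}) (at_right (0::real))"
      using r by (intro eventually_at_right_real) simp
    then show "eventually (\<lambda>t. norm (c n - \<mu> n) \<le> (C + B) * t) (at_right 0)"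
      by eventually_elim (use key in auto)
  qed simp
  then show ?case by (simp add: \<mu>_def)
qed

context real_distribution
begin

lemma moments_of_analytic_char:
  assumes r: "0 < r" and an: "analytic_in_disk (char M) r c"
  shows "integrable M (\<lambda>x. x ^ k)"
    and "c k = \<i> ^ k * of_real (expectation (\<lambda>x. x ^ k) / fact k)"
proof -
  from an obtain F where "\<forall>z\<in>ball 0 r. (\<lambda>k. c k * z ^ k) sums F z"
    "\<forall>t. \<bar>t\<bar> < r \<longrightarrow> F (of_real t) = char M t"
    unfolding analytic_in_disk_def by blast
  then have F: "\<And>z. norm z < r \<Longrightarrow> (\<lambda>k. c k * z ^ k) sums F z"
    "\<And>t. \<bar>t\<bar> < r \<Longrightarrow> F (of_real t) = char M t"
    by simp_all
  have int: "integrable M (\<lambda>x. x ^ k)" for k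
    by (rule integrable_power_of_even[of "\<lambda>x. x"]) (auto intro: even_moment_of_power_series[OF r F])
  then show "integrable M (\<lambda>x. x ^ k)" .
  show "c k = \<i> ^ k * of_real (expectation (\<lambda>x. x ^ k) / fact k)"
    by (rule power_series_coeff_eq_moment[OF r F int])
qed

end

section \<open>Sequences with finitely many values\<close>

text \<open>
  Values from a finite set cannot decrease by less than the smallest gap between two of them, so an
  almost nondecreasing sequence is eventually nondecreasing, and then it reaches its maximum and stays.
\<close>

lemma finite_range_almost_nondecreasing_eventually_const:
  fixes u :: "nat \<Rightarrow> real"
  assumes fin: "finite (range u)"
    and almost: "\<And>\<epsilon>. 0 < \<epsilon> \<Longrightarrow> eventually (\<lambda>k. u k - \<epsilon> < u (Suc k)) sequentially"
  obtains c where "eventually (\<lambda>k. u k = c) sequentially"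
proof -
  define D where "D = {d \<in> (\<lambda>(a, b). a - b) ` (range u \<times> range u). 0 < d}"
  have "finite D" unfolding D_def using fin by simp
  \<comment> \<open>Inserting 1 keeps the minimum meaningful when the sequence has only one value.\<close>
  define \<delta> where "\<delta> = Min (insert 1 D)"
  have "0 < \<delta>" using \<open>finite D\<close> by (auto simp: \<delta>_def D_def)
  from almost[OF this] obtain N where N: "\<And>k. N \<le> k \<Longrightarrow> u k - \<delta> < u (Suc k)"
    by (auto simp: eventually_sequentially)
  have step: "u k \<le> u (Suc k)" if "N \<le> k" for k
  proof (rule ccontr)
    assume "\<not> u k \<le> u (Suc k)"
    then have "u k - u (Suc k) \<in> D" by (auto simp: D_def)
    then have "\<delta> \<le> u k - u (Suc k)" using \<open>finite D\<close> by (simp add: \<delta>_def)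
    with N[OF that] show False by simp
  qed
  have mono: "u k \<le> u l" if "N \<le> k" "k \<le> l" for k l
    using that(2,1) by (induction rule: dec_induct) (auto intro: order_trans step)
  have finN: "finite (u ` {N..})" using fin by (rule finite_subset[rotated]) auto
  then have "Max (u ` {N..}) \<in> u ` {N..}" by (intro Max_in) auto
  then obtain K where K: "N \<le> K" "u K = Max (u ` {N..})" by auto
  have "u k = u K" if "K \<le> k" for k
    using mono[OF K(1) that] K that finN by (auto intro!: antisym Max_ge)
  then show ?thesis using that by (auto simp: eventually_sequentially)
qed

text \<open>
  The ratios of successive terms are almost nondecreasing and take finitely many values, hence they
  are eventually constant; two equal terms of the resulting geometric sequence force its ratio to be 1.
\<close>

lemma finite_range_almost_log_convex_eventually_const:
  fixes v w :: "nat \<Rightarrow> real"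
  assumes fin: "finite (range v)" and pos: "\<And>k. 0 < v k"
    and lc: "\<And>k. (v (Suc k))\<^sup>2 \<le> w k * (v k * v (Suc (Suc k)))" and w: "w \<longlonglongrightarrow> 1"
  obtains c where "0 < c" "eventually (\<lambda>k. v k = c) sequentially"
proof -
  define \<rho> where "\<rho> k = v (Suc k) / v k" for k
  have \<rho>_pos: "0 < \<rho> k" for k using pos by (simp add: \<rho>_def)
  have "range \<rho> \<subseteq> (\<lambda>(a, b). a / b) ` (range v \<times> range v)" by (auto simp: \<rho>_def)
  then have fin\<rho>: "finite (range \<rho>)" by (rule finite_subset) (use fin in simp)
  define C where "C = Max (range \<rho>)"
  have C: "\<rho> k \<le> C" for k using fin\<rho> by (simp add: C_def)
  have "0 < C" using C[of 0] \<rho>_pos[of 0] by linarith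
  have almost: "\<rho> k \<le> w k * \<rho> (Suc k)" for k
    using lc[of k] pos[of k] pos[of "Suc k"] by (simp add: \<rho>_def field_simps power2_eq_square)
  obtain c where c: "eventually (\<lambda>k. \<rho> k = c) sequentially"
  proof (rule finite_range_almost_nondecreasing_eventually_const[OF fin\<rho>])
    fix \<epsilon> :: real assume "0 < \<epsilon>"
    then have "eventually (\<lambda>k. dist (w k) 1 < \<epsilon> / C) sequentially"
      using \<open>0 < C\<close> by (intro tendstoD[OF w]) simp
    then show "eventually (\<lambda>k. \<rho> k - \<epsilon> < \<rho> (Suc k)) sequentially"
    proof eventually_elim
      case (elim k)
      have "\<rho> k - \<rho> (Suc k) \<le> (w k - 1) * \<rho> (Suc k)"
        using almost[of k] by (simp add: algebra_simps)
      also have "\<dots> \<le> \<bar>w k - 1\<bar> * C"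
        using C[of "Suc k"] \<rho>_pos[of "Suc k"] by (intro mult_mono) auto
      also have "\<dots> < \<epsilon>" using elim \<open>0 < C\<close> by (simp add: dist_real_def field_simps)
      finally show ?case by simp
    qed
  qed
  then obtain N where N: "\<And>k. N \<le> k \<Longrightarrow> \<rho> k = c" by (auto simp: eventually_sequentially)
  have "0 < c" using N[of N] \<rho>_pos[of N] by simp
  have geometric: "v (N + j) = v N * c ^ j" for j
  proof (induction j)
    case (Suc j)
    have "v (N + Suc j) = c * v (N + j)"
      using N[of "N + j"] pos[of "N + j"] by (simp add: \<rho>_def field_simps)
    then show ?case using Suc by simp
  qed simp
  have "\<not> inj (\<lambda>j. v (N + j))"
  proof
    assume "inj (\<lambda>j. v (N + j))"
    then have "infinite (range (\<lambda>j. v (N + j)))" by (rule range_inj_infinite)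
    moreover have "range (\<lambda>j. v (N + j)) \<subseteq> range v" by auto
    ultimately show False using fin finite_subset by blast
  qed
  then obtain i j where "i < j" "v (N + i) = v (N + j)"
    unfolding inj_def by (metis linorder_neqE_nat)
  then have "c ^ i * c ^ (j - i) = c ^ i * 1"
    using pos[of N] power_add[of c i "j - i"] by (simp add: geometric)
  then have "c ^ (j - i) = 1" using \<open>0 < c\<close> by simp
  then have "c = 1" using \<open>i < j\<close> \<open>0 < c\<close> by (intro power_eq_imp_eq_base[of c "j - i" 1]) auto
  then have "eventually (\<lambda>k. v k = v N) sequentially"
    using geometric by (auto simp: eventually_sequentially intro!: exI[of _ N] dest!: le_Suc_ex)
  then show ?thesis using that pos by blast
qed

section \<open>Eventual periodicity of the moment ratios\<close>

lemma integral_Cauchy_Schwarz: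
  fixes f g :: "'a \<Rightarrow> real"
  assumes "integrable M (\<lambda>x. (f x)\<^sup>2)" "integrable M (\<lambda>x. (g x)\<^sup>2)" "integrable M (\<lambda>x. f x * g x)"
  shows "(\<integral>x. f x * g x \<partial>M)\<^sup>2 \<le> (\<integral>x. (f x)\<^sup>2 \<partial>M) * (\<integral>x. (g x)\<^sup>2 \<partial>M)"
proof -
  let ?a = "\<integral>x. (f x)\<^sup>2 \<partial>M" and ?b = "\<integral>x. f x * g x \<partial>M" and ?c = "\<integral>x. (g x)\<^sup>2 \<partial>M"
  have quad: "0 \<le> ?a * s\<^sup>2 + 2 * ?b * s + ?c" for s
  proof -
    have "0 \<le> (\<integral>x. (s * f x + g x)\<^sup>2 \<partial>M)" by (rule integral_nonneg_AE) simp
    also have "\<dots> = (\<integral>x. s\<^sup>2 * (f x)\<^sup>2 + 2 * s * (f x * g x) + (g x)\<^sup>2 \<partial>M)"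
      by (simp add: power2_eq_square algebra_simps)
    also have "\<dots> = s\<^sup>2 * ?a + 2 * s * ?b + ?c" using assms by simp
    finally show ?thesis by (simp add: mult_ac)
  qed
  have "0 \<le> ?a" by (rule integral_nonneg_AE) simp
  then consider "?a = 0" | "0 < ?a" by linarith
  then show ?thesis
  proof cases
    case 1
    then have "?b = 0" using quad[of "- (?c + 1) / (2 * ?b)"] by (cases "?b = 0") auto
    then show ?thesis using 1 by simp
  next
    case 2
    then have "0 \<le> ?c - ?b\<^sup>2 / ?a"
      using quad[of "- ?b / ?a"] by (simp add: power2_eq_square field_simps)
    then show ?thesis using 2 by (simp add: field_simps)
  qed
qed

lemma fact_one_step: "n = m + 1 \<Longrightarrow> fact n = (real m + 1) * fact m"
  by (simp add: add.commute)

lemma fact_two_steps: "n = m + 2 \<Longrightarrow> fact n = (real m + 2) * (real m + 1) * fact m"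
  by (simp add: numeral_2_eq_2 add.commute)

context real_distribution
begin

lemma moment_Cauchy_Schwarz:
  assumes int: "\<And>k. integrable M (\<lambda>x. x ^ k)"
  shows "(expectation (\<lambda>x. x ^ (k + l)))\<^sup>2 \<le> expectation (\<lambda>x. x ^ (2 * k)) * expectation (\<lambda>x. x ^ (2 * l))"
proof -
  have "integrable M (\<lambda>x. (x ^ k)\<^sup>2)" for k
    using int[of "2 * k"] by (simp add: power_mult[symmetric] mult.commute)
  then show ?thesis
    using integral_Cauchy_Schwarz[of M "\<lambda>x. x ^ k" "\<lambda>x. x ^ l"] int[of "k + l"]
    by (simp add: power_add power_mult power_mult[symmetric, of _ _ 2] mult.commute[of _ 2])
qed

lemma even_moment_pos:
  assumes "integrable M (\<lambda>x. x ^ (2 * k))" and "\<not> (AE x in M. x = 0)"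
  shows "0 < expectation (\<lambda>x. x ^ (2 * k))"
proof -
  have "0 \<le> expectation (\<lambda>x. x ^ (2 * k))"
    by (rule integral_nonneg_AE) (simp add: power_mult)
  moreover have "expectation (\<lambda>x. x ^ (2 * k)) \<noteq> 0"
  proof
    assume "expectation (\<lambda>x. x ^ (2 * k)) = 0"
    then have "AE x in M. x ^ (2 * k) = 0"
      using assms(1) by (subst (asm) integral_nonneg_eq_0_iff_AE) (auto simp: power_mult)
    then have "AE x in M. x = 0" by eventually_elim simp
    then show False using assms(2) by simp
  qed
  ultimately show ?thesis by (metis order_le_less)
qed

text \<open>
  For the odd ratios, Cauchy-Schwarz is applied to the factors \<open>x^k\<close> and
  \<open>x^(k + 1) (x^2 / s - 1)\<close> with \<open>s = (2 k + 2) (2 k + 3)\<close>. The factor \<open>s\<close> makes their product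
  integrate to \<open>(2 k + 1)!\<close> times a difference of successive odd ratios, while the squares
  involve even moments only. With the even ratios constant, the bound is \<open>A^2 e\<^sub>k\<close> for an
  explicit rational sequence \<open>e\<^sub>k \<longlonglongrightarrow> 0\<close>. The same inequality with plain powers compares \<open>B\<close> with \<open>A\<close>.
\<close>

lemma moment_ratios_eventually_periodic:
  defines "m \<equiv> \<lambda>k. expectation (\<lambda>x. x ^ k) / fact k"
  assumes int: "\<And>k. integrable M (\<lambda>x. x ^ k)" and nz: "\<not> (AE x in M. x = 0)"
    and fin: "finite (range m)"
  obtains p q where "0 \<le> p" "0 \<le> q" "eventually (\<lambda>k. m k = p + (-1) ^ k * q) sequentially"
proof -
  have mom: "expectation (\<lambda>x. x ^ k) = fact k * m k" for k by (simp add: m_def)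
  have CS: "(fact (k + l) * m (k + l))\<^sup>2 \<le> (fact (2 * k) * m (2 * k)) * (fact (2 * l) * m (2 * l))" for k l
    using moment_Cauchy_Schwarz[OF int, of k l] unfolding mom .
  \<comment> \<open>\<open>w k\<close> is the quotient \<open>(2 k)! (2 k + 4)! / ((2 k + 2)!)^2\<close> left over when moments are replaced by ratios.\<close>
  define w where "w k = ((2 * real k + 4) * (2 * real k + 3)) / ((2 * real k + 2) * (2 * real k + 1))" for k
  obtain A where A: "0 < A" "eventually (\<lambda>k. m (2 * k) = A) sequentially"
  proof (rule finite_range_almost_log_convex_eventually_const)
    show "finite (range (\<lambda>k. m (2 * k)))" using fin by (rule finite_subset[rotated]) auto
    show "0 < m (2 * k)" for k using even_moment_pos[OF int nz, of k] by (simp add: m_def)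
    show "w \<longlonglongrightarrow> 1" unfolding w_def by real_asymp
    show "(m (2 * Suc k))\<^sup>2 \<le> w k * (m (2 * k) * m (2 * Suc (Suc k)))" for k
    proof -
      have f2: "fact (2 * k + 2) = (2 * real k + 2) * (2 * real k + 1) * fact (2 * k)"
        by (subst fact_two_steps[of _ "2 * k"]) (simp_all add: algebra_simps del: fact_Suc)
      have f4: "fact (2 * k + 4) = (2 * real k + 4) * (2 * real k + 3) * fact (2 * k + 2)"
        by (subst fact_two_steps[of _ "2 * k + 2"]) (simp_all add: algebra_simps del: fact_Suc)
      have "fact (2 * k + 2) * fact (2 * k + 2) * (m (2 * k + 2))\<^sup>2
          \<le> fact (2 * k) * fact (2 * k + 4) * (m (2 * k) * m (2 * k + 4))"
      proof -
        have "k + (k + 2) = 2 * k + 2" "2 * (k + 2) = 2 * k + 4" by simp_all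
        then show ?thesis using CS[of k "k + 2"] by (simp only: power2_eq_square mult_ac)
      qed
      also have "fact (2 * k) * fact (2 * k + 4) = fact (2 * k + 2) * fact (2 * k + 2) * w k"
      proof -
        have "w k * ((2 * real k + 2) * (2 * real k + 1)) = (2 * real k + 4) * (2 * real k + 3)"
        proof -
          have "(2 * real k + 2) * (2 * real k + 1) \<noteq> 0"
            using of_nat_0_le_iff[of k, where 'a = real] by (simp only: mult_eq_0_iff) linarith
          then show ?thesis unfolding w_def by simp
        qed
        then have "fact (2 * k + 4) = w k * ((2 * real k + 2) * (2 * real k + 1)) * fact (2 * k + 2)"
          unfolding f4 by simp
        then show ?thesis unfolding f2 by (simp only: mult_ac)
      qed
      finally have "(m (2 * k + 2))\<^sup>2 \<le> w k * (m (2 * k) * m (2 * k + 4))"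
        by (simp add: mult.assoc)
      then show ?thesis by (simp add: numeral_eq_Suc)
    qed
  qed
  then obtain N where N: "\<And>k. N \<le> k \<Longrightarrow> m (2 * k) = A" by (auto simp: eventually_sequentially)
  define e where "e k = (2 * real k + 2) / (2 * real k + 1) *
      (((2 * real k + 6) * (2 * real k + 5) * (2 * real k + 4) * (2 * real k + 3)) / ((2 * real k + 2) * (2 * real k + 3))\<^sup>2
        - 2 * ((2 * real k + 4) * (2 * real k + 3)) / ((2 * real k + 2) * (2 * real k + 3)) + 1)" for k
  have e: "e \<longlonglongrightarrow> 0" unfolding e_def by real_asymp
  have diff: "(m (2 * k + 3) - m (2 * k + 1))\<^sup>2 \<le> A\<^sup>2 * e k" if k: "N \<le> k" for k
  proof -
    define s where "s = (2 * real k + 2) * (2 * real k + 3)"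
    have "s > 0" by (simp add: s_def)
    have i3: "2 * k + 1 + 2 = 2 * k + 3" and i4: "2 * k + 2 + 2 = 2 * k + 4" and i6: "2 * k + 2 + 4 = 2 * k + 6"
      by simp_all
    let ?f = "\<lambda>x::real. x ^ k" and ?g = "\<lambda>x::real. x ^ (k + 1) * (x\<^sup>2 / s - 1)"
    have ff: "(\<lambda>x. (?f x)\<^sup>2) = (\<lambda>x. x ^ (2 * k))"
      by (simp add: power_mult[symmetric] mult.commute)
    have fg: "(\<lambda>x. ?f x * ?g x) = (\<lambda>x. x ^ (2 * k + 3) / s - x ^ (2 * k + 1))"
    proof
      fix x :: real
      have "x ^ k * x ^ (k + 1) = x ^ (2 * k + 1)"
        by (simp only: power_add[symmetric]) (simp add: mult_2)
      then have "?f x * ?g x = x ^ (2 * k + 1) * (x\<^sup>2 / s - 1)"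
        by (simp only: mult.assoc[symmetric])
      also have "\<dots> = x ^ (2 * k + 1 + 2) / s - x ^ (2 * k + 1)"
        unfolding power_add[of x "2 * k + 1"] by (simp add: algebra_simps)
      finally show "?f x * ?g x = x ^ (2 * k + 3) / s - x ^ (2 * k + 1)"
        by (simp only: i3)
    qed
    have gg: "(\<lambda>x. (?g x)\<^sup>2) = (\<lambda>x. x ^ (2 * k + 6) / s\<^sup>2 - 2 * x ^ (2 * k + 4) / s + x ^ (2 * k + 2))"
    proof
      fix x :: real
      have "(x ^ (k + 1))\<^sup>2 = x ^ (2 * k + 2)"
        by (simp only: power2_eq_square power_add[symmetric]) (simp add: mult_2)
      moreover have "(x\<^sup>2 / s - 1)\<^sup>2 = x ^ 4 / s\<^sup>2 - 2 * x\<^sup>2 / s + 1"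
        by (simp add: power2_diff power_divide)
      ultimately have "(?g x)\<^sup>2 = x ^ (2 * k + 2) * (x ^ 4 / s\<^sup>2 - 2 * x\<^sup>2 / s + 1)"
        by (simp only: power_mult_distrib)
      also have "\<dots> = x ^ (2 * k + 2 + 4) / s\<^sup>2 - 2 * x ^ (2 * k + 2 + 2) / s + x ^ (2 * k + 2)"
        unfolding power_add[of x "2 * k + 2"] by (simp add: algebra_simps)
      finally show "(?g x)\<^sup>2 = x ^ (2 * k + 6) / s\<^sup>2 - 2 * x ^ (2 * k + 4) / s + x ^ (2 * k + 2)"
        by (simp only: i4 i6)
    qed
    have int2: "integrable M (\<lambda>x. x ^ a / s - x ^ b)" for a b :: nat
      using int by simp
    have int3: "integrable M (\<lambda>x. x ^ a / s\<^sup>2 - 2 * x ^ b / s + x ^ c)" for a b c :: nat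
      using int by simp
    have lin2: "expectation (\<lambda>x. x ^ a / s - x ^ b)
        = expectation (\<lambda>x. x ^ a) / s - expectation (\<lambda>x. x ^ b)" for a b :: nat
      using int by simp
    have lin3: "expectation (\<lambda>x. x ^ a / s\<^sup>2 - 2 * x ^ b / s + x ^ c)
        = expectation (\<lambda>x. x ^ a) / s\<^sup>2 - 2 * expectation (\<lambda>x. x ^ b) / s + expectation (\<lambda>x. x ^ c)"
      for a b c :: nat
      using int by simp
    have f1: "fact (2 * k + 1) = (2 * real k + 1) * fact (2 * k)"
      by (subst fact_one_step[of _ "2 * k"]) simp_all
    have f2: "fact (2 * k + 2) = (2 * real k + 2) * fact (2 * k + 1)"
      by (subst fact_one_step[of _ "2 * k + 1"]) simp_all
    have f3: "fact (2 * k + 3) = s * fact (2 * k + 1)"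
      by (subst fact_two_steps[of _ "2 * k + 1"]) (simp_all add: s_def algebra_simps del: fact_Suc)
    have f4: "fact (2 * k + 4) = (2 * real k + 4) * (2 * real k + 3) * fact (2 * k + 2)"
      by (subst fact_two_steps[of _ "2 * k + 2"]) (simp_all add: algebra_simps del: fact_Suc)
    have f6: "fact (2 * k + 6) = (2 * real k + 6) * (2 * real k + 5) * fact (2 * k + 4)"
      by (subst fact_two_steps[of _ "2 * k + 4"]) (simp_all add: algebra_simps del: fact_Suc)
    have "(\<integral>x. ?f x * ?g x \<partial>M)\<^sup>2 \<le> (\<integral>x. (?f x)\<^sup>2 \<partial>M) * (\<integral>x. (?g x)\<^sup>2 \<partial>M)"
      by (rule integral_Cauchy_Schwarz; unfold ff fg gg; intro int int2 int3)
    also have "(\<integral>x. ?f x * ?g x \<partial>M) = fact (2 * k + 1) * (m (2 * k + 3) - m (2 * k + 1))"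
    proof -
      have "s * F * a / s - F * b = F * (a - b)" for F a b
        using \<open>s > 0\<close> by (simp add: algebra_simps)
      then show ?thesis unfolding fg lin2 mom f3 .
    qed
    also have "(\<integral>x. (?f x)\<^sup>2 \<partial>M) = fact (2 * k) * A"
      unfolding ff mom using N[OF k] by simp
    also have "(\<integral>x. (?g x)\<^sup>2 \<partial>M) = fact (2 * k + 6) * m (2 * k + 6) / s\<^sup>2
        - 2 * (fact (2 * k + 4) * m (2 * k + 4)) / s + fact (2 * k + 2) * m (2 * k + 2)"
      unfolding gg lin3 mom ..
    also have "\<dots> = A * (fact (2 * k + 6) / s\<^sup>2 - 2 * fact (2 * k + 4) / s + fact (2 * k + 2))"
    proof -
      have idx: "2 * (k + 1) = 2 * k + 2" "2 * (k + 2) = 2 * k + 4" "2 * (k + 3) = 2 * k + 6"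
        by simp_all
      have "m (2 * k + 2) = A" "m (2 * k + 4) = A" "m (2 * k + 6) = A"
        unfolding idx[symmetric] by (rule N; use k in simp)+
      moreover have "x * A / s\<^sup>2 - 2 * (y * A) / s + z * A = A * (x / s\<^sup>2 - 2 * y / s + z)" for x y z
        by (simp add: algebra_simps)
      ultimately show ?thesis by (simp only:)
    qed
    also have "fact (2 * k) * A * \<dots> = (fact (2 * k + 1))\<^sup>2 * (A\<^sup>2 * e k)"
    proof -
      have aux: "F * A * (A * (a6 * a5 * (a4 * a3 * (a2 * (a1 * F))) / s\<^sup>2 - 2 * (a4 * a3 * (a2 * (a1 * F))) / s + a2 * (a1 * F)))
          = (a1 * F)\<^sup>2 * (A\<^sup>2 * (a2 / a1 * (a6 * a5 * a4 * a3 / s\<^sup>2 - 2 * (a4 * a3) / s + 1)))"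
        if "a1 \<noteq> 0" for F a1 a2 a3 a4 a5 a6 :: real
      proof -
        define b P Q where "b = a2 / a1" and "P = a6 * a5 * a4 * a3 / s\<^sup>2" and "Q = a4 * a3 / s"
        have "a2 = b * a1" using that by (simp add: b_def)
        moreover have "a6 * a5 * (a4 * a3 * (a2 * (a1 * F))) / s\<^sup>2 = P * (a2 * (a1 * F))"
          by (simp add: P_def)
        moreover have "2 * (a4 * a3 * (a2 * (a1 * F))) / s = 2 * Q * (a2 * (a1 * F))"
          by (simp add: Q_def)
        moreover have "2 * (a4 * a3) / s = 2 * Q"
          by (simp add: Q_def)
        moreover have "F * A * (A * (P * (b * a1 * (a1 * F)) - 2 * Q * (b * a1 * (a1 * F)) + b * a1 * (a1 * F)))
            = (a1 * F)\<^sup>2 * (A\<^sup>2 * (b * (P - 2 * Q + 1)))"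
          by algebra
        ultimately show ?thesis
          unfolding b_def[symmetric] P_def[symmetric] by (simp only:)
      qed
      show ?thesis
        unfolding f6 f4 f2 f1 e_def s_def[symmetric] by (rule aux) linarith
    qed
    finally show ?thesis by (simp add: power_mult_distrib del: fact_Suc)
  qed
  obtain B where "eventually (\<lambda>k. m (2 * k + 1) = B) sequentially"
  proof (rule finite_range_almost_nondecreasing_eventually_const)
    show "finite (range (\<lambda>k. m (2 * k + 1)))" using fin by (rule finite_subset[rotated]) auto
    fix \<epsilon> :: real assume "0 < \<epsilon>"
    have "(\<lambda>k. A\<^sup>2 * e k) \<longlonglongrightarrow> 0" using tendsto_mult_right_zero[OF e] .
    then have "eventually (\<lambda>k. A\<^sup>2 * e k < \<epsilon>\<^sup>2) sequentially"
      using \<open>0 < \<epsilon>\<close> by (intro order_tendstoD) auto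
    with eventually_ge_at_top[of N]
    show "eventually (\<lambda>k. m (2 * k + 1) - \<epsilon> < m (2 * Suc k + 1)) sequentially"
    proof eventually_elim
      case (elim k)
      then have "\<bar>m (2 * k + 3) - m (2 * k + 1)\<bar>\<^sup>2 < \<epsilon>\<^sup>2" using diff[of k] by simp
      then have "\<bar>m (2 * k + 3) - m (2 * k + 1)\<bar> < \<epsilon>"
        using \<open>0 < \<epsilon>\<close> by (intro power_less_imp_less_base[of _ 2 \<epsilon>]) auto
      then show ?case by (simp add: numeral_eq_Suc)
    qed
  qed
  then obtain N' where N': "\<And>k. N' \<le> k \<Longrightarrow> m (2 * k + 1) = B" by (auto simp: eventually_sequentially)
  have "B\<^sup>2 \<le> A\<^sup>2"
  proof (rule tendsto_lowerbound)
    show "(\<lambda>k. (2 * real k + 2) / (2 * real k + 1) * A\<^sup>2) \<longlonglongrightarrow> A\<^sup>2" by real_asymp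
    show "eventually (\<lambda>k. B\<^sup>2 \<le> (2 * real k + 2) / (2 * real k + 1) * A\<^sup>2) sequentially"
      using eventually_ge_at_top[of "max N N'"]
    proof eventually_elim
      case (elim k)
      have "(fact (2 * k + 1))\<^sup>2 * B\<^sup>2 \<le> fact (2 * k) * fact (2 * k + 2) * A\<^sup>2"
      proof -
        have "k + (k + 1) = 2 * k + 1" "2 * (k + 1) = 2 * k + 2" by simp_all
        moreover have "m (2 * k) = A" "m (2 * k + 2) = A" "m (2 * k + 1) = B"
          using N[of k] N[of "k + 1"] N'[of k] elim by simp_all
        ultimately show ?thesis using CS[of k "k + 1"] by (simp only: power2_eq_square mult_ac)
      qed
      also have "fact (2 * k) * fact (2 * k + 2) = (fact (2 * k + 1))\<^sup>2 * ((2 * real k + 2) / (2 * real k + 1))"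
      proof -
        have "F * (a2 * (a1 * F)) = (a1 * F)\<^sup>2 * (a2 / a1)" if "a1 \<noteq> 0" for F a1 a2 :: real
          using that by (simp add: field_simps power2_eq_square)
        moreover have "fact (2 * k + 1) = (2 * real k + 1) * fact (2 * k)"
          by (subst fact_one_step[of _ "2 * k"]) simp_all
        moreover have "fact (2 * k + 2) = (2 * real k + 2) * fact (2 * k + 1)"
          by (subst fact_one_step[of _ "2 * k + 1"]) simp_all
        moreover have "2 * real k + 1 \<noteq> 0" by linarith
        ultimately show ?thesis by (simp only:)
      qed
      finally have "(fact (2 * k + 1))\<^sup>2 * B\<^sup>2
          \<le> (fact (2 * k + 1))\<^sup>2 * ((2 * real k + 2) / (2 * real k + 1) * A\<^sup>2)"
        by (simp only: mult.assoc)
      then show ?case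
        by (rule mult_left_le_imp_le) (simp only: zero_less_power fact_gt_zero)
    qed
  qed simp
  then have "\<bar>B\<bar> \<le> A" using A(1) abs_le_square_iff[of B A] by simp
  moreover have "m k = (A + B) / 2 + (-1) ^ k * ((A - B) / 2)" if "2 * (N + N') \<le> k" for k
  proof (cases "even k")
    case True
    then show ?thesis using N[of "k div 2"] that by (simp add: field_simps)
  next
    case False
    then show ?thesis using N'[of "k div 2"] that by (simp add: field_simps)
  qed
  ultimately show ?thesis
    by (intro that[of "(A + B) / 2" "(A - B) / 2"]) (auto simp: eventually_sequentially)
qed

end

section \<open>Continuation along the real line and behaviour at infinity\<close>

text \<open>
  A nonconstant polynomial tends to infinity in every direction, in particular along the real axis.
\<close>

lemma bounded_polynomial_on_reals_const:
  fixes P :: "complex poly"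
  assumes "\<And>t. norm (poly P (of_real t)) \<le> C"
  obtains a where "P = [:a:]"
proof -
  obtain a Q where P: "P = pCons a Q" by (cases P)
  have "Q = 0"
  proof (rule ccontr)
    assume "Q \<noteq> 0"
    from poly_infinity[OF this, of "C + 1" a] obtain r
      where r: "\<And>z. r \<le> norm z \<Longrightarrow> C + 1 \<le> norm (poly P z)" unfolding P by blast
    have "C + 1 \<le> norm (poly P (of_real r))" by (rule r) simp
    then show False using assms[of r] by simp
  qed
  then show ?thesis using that P by simp
qed

context real_distribution
begin

text \<open>
  Odd absolute moments are controlled by the two neighbouring even ones through
  \<open>\<bar>x\<bar> \<le> 1 + x^2\<close>; this costs the factor that is linear in \<open>k\<close> and leaves the radius of convergence at 1.
\<close>

lemma absolute_moment_bound:
  assumes int: "\<And>k. integrable M (\<lambda>x. x ^ k)"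
    and bd: "\<And>k. \<bar>expectation (\<lambda>x. x ^ k) / fact k\<bar> \<le> C"
  shows "expectation (\<lambda>x. \<bar>x\<bar> ^ k) / fact k \<le> C * (real k + 2)"
proof -
  have "0 \<le> C" using bd[of 0] by linarith
  show ?thesis
  proof (cases "even k")
    case True
    have "expectation (\<lambda>x. \<bar>x\<bar> ^ k) / fact k \<le> C * 1"
      using order_trans[OF abs_ge_self bd[of k]] True by (simp add: power_even_abs)
    also have "\<dots> \<le> C * (real k + 2)" using \<open>0 \<le> C\<close> by (intro mult_left_mono) auto
    finally show ?thesis .
  next
    case False
    then obtain j where k: "k = Suc (2 * j)" by (elim oddE) simp
    have "\<bar>x\<bar> ^ k \<le> x ^ (2 * j) + x ^ (2 * j + 2)" for x :: real
    proof -
      have "\<bar>x\<bar> \<le> 1 + x\<^sup>2"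
        using zero_le_power2[of "\<bar>x\<bar> - 1"] by (simp add: power2_diff)
      then have "\<bar>x\<bar> * \<bar>x\<bar> ^ (2 * j) \<le> (1 + x\<^sup>2) * \<bar>x\<bar> ^ (2 * j)" by (intro mult_right_mono) auto
      then show ?thesis by (simp add: k power_even_abs power_add algebra_simps power2_eq_square)
    qed
    moreover have "integrable M (\<lambda>x. \<bar>x\<bar> ^ k)"
      using integrable_abs[OF int[of k]] by (simp only: power_abs)
    ultimately have "expectation (\<lambda>x. \<bar>x\<bar> ^ k) \<le> expectation (\<lambda>x. x ^ (2 * j) + x ^ (2 * j + 2))"
      by (intro integral_mono Bochner_Integration.integrable_add int)
    also have "\<dots> = expectation (\<lambda>x. x ^ (2 * j)) + expectation (\<lambda>x. x ^ (2 * j + 2))"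
      by (intro Bochner_Integration.integral_add int)
    also have "\<dots> \<le> C * fact (2 * j) + C * fact (2 * j + 2)"
      using bd[of "2 * j"] bd[of "2 * j + 2"]
      by (intro add_mono) (simp_all add: divide_le_eq abs_le_iff del: fact_Suc add_2_eq_Suc')
    also have "\<dots> \<le> C * fact k + C * fact (2 * j + 2)"
      using \<open>0 \<le> C\<close> by (intro add_mono mult_left_mono fact_mono) (auto simp: k)
    also have "fact (2 * j + 2) = (real k + 1) * fact k"
      by (subst fact_one_step[of _ k]) (simp_all add: k)
    finally have "expectation (\<lambda>x. \<bar>x\<bar> ^ k) \<le> C * (real k + 2) * fact k"
      by (simp add: algebra_simps del: fact_Suc)
    then show ?thesis by (simp add: divide_le_eq)
  qed
qed

text \<open>
  The extension is the Taylor series at \<open>u\<close>: \<open>exp (i t x)\<close> is expanded in powers of \<open>t - u\<close> under the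
  integral, with the growth of the absolute moments justifying termwise integration.
\<close>

lemma char_holomorphic_extension:
  assumes int: "\<And>k. integrable M (\<lambda>x. x ^ k)"
    and bd: "\<And>k. \<bar>expectation (\<lambda>x. x ^ k) / fact k\<bar> \<le> C"
  obtains F where "F holomorphic_on ball (of_real u) 1"
    "\<And>t. \<bar>t - u\<bar> < 1 \<Longrightarrow> F (of_real t) = char M t"
proof -
  define \<alpha> where "\<alpha> k = \<i> ^ k / fact k * (CLINT x|M. of_real (x ^ k) * iexp (u * x))" for k
  define F where "F z = (\<Sum>k. \<alpha> k * (z - of_real u) ^ k)" for z
  have absint: "integrable M (\<lambda>x. \<bar>x\<bar> ^ k)" for k
    using integrable_abs[OF int[of k]] by (simp only: power_abs)
  have term_int: "complex_integrable M (\<lambda>x. of_real (x ^ k) * iexp (u * x))" for k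
    by (rule Bochner_Integration.integrable_bound[OF absint[of k]]) (auto simp: norm_mult norm_power)
  have maj: "summable (\<lambda>k. C * (real k + 2) * s ^ k)" if s: "0 \<le> s" "s < 1" for s :: real
  proof -
    have "summable (\<lambda>k. real (Suc k) * s ^ k)"
      using geometric_deriv_sums[of s] s by (simp add: sums_iff)
    moreover have "summable (\<lambda>k. s ^ k)" using s by (intro summable_geometric) simp
    ultimately have "summable (\<lambda>k. C * (real (Suc k) * s ^ k + s ^ k))"
      by (intro summable_mult summable_add)
    then show ?thesis by (simp add: algebra_simps)
  qed
  have \<alpha>_bound: "norm (\<alpha> k) \<le> C * (real k + 2)" for k
  proof -
    have "norm (CLINT x|M. of_real (x ^ k) * iexp (u * x)) \<le> expectation (\<lambda>x. norm (complex_of_real (x ^ k) * iexp (u * x)))"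
      by (rule integral_norm_bound)
    also have "\<dots> = expectation (\<lambda>x. \<bar>x\<bar> ^ k)" by (simp add: norm_mult norm_power)
    finally have "norm (\<alpha> k) \<le> expectation (\<lambda>x. \<bar>x\<bar> ^ k) / fact k"
      by (simp add: \<alpha>_def norm_mult norm_divide norm_power divide_right_mono)
    also have "\<dots> \<le> C * (real k + 2)" by (rule absolute_moment_bound[OF int bd])
    finally show ?thesis .
  qed
  have "F holomorphic_on ball (of_real u) 1"
  proof (rule power_series_holomorphic)
    fix w assume "w \<in> ball (complex_of_real u) 1"
    then have w: "norm (w - of_real u) < 1" by (simp add: dist_norm norm_minus_commute)
    have "summable (\<lambda>k. \<alpha> k * (w - of_real u) ^ k)"
    proof (rule summable_comparison_test'[OF maj[OF _ w], of 0])
      fix k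
      show "norm (\<alpha> k * (w - of_real u) ^ k) \<le> C * (real k + 2) * norm (w - of_real u) ^ k"
        unfolding norm_mult norm_power by (intro mult_right_mono \<alpha>_bound) auto
    qed simp
    then show "(\<lambda>k. \<alpha> k * (w - of_real u) ^ k) sums F w"
      unfolding F_def by (rule summable_sums)
  qed
  moreover have "F (of_real t) = char M t" if t: "\<bar>t - u\<bar> < 1" for t
  proof -
    define h where "h = t - u"
    let ?g = "\<lambda>k x. (\<i> * of_real h) ^ k / fact k * (of_real (x ^ k) * iexp (u * x))"
    have norm_g: "norm (?g k x) = \<bar>h\<bar> ^ k / fact k * \<bar>x\<bar> ^ k" for k x
      by (simp add: norm_mult norm_divide norm_power)
    have g_sums: "(\<lambda>k. ?g k x) sums iexp (t * x)" for x
    proof -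
      have "(\<lambda>k. (\<i> * of_real (h * x)) ^ k /\<^sub>R fact k * iexp (u * x)) sums (iexp (h * x) * iexp (u * x))"
        by (intro sums_mult2 exp_converges)
      moreover have "iexp (h * x) * iexp (u * x) = iexp (t * x)"
        by (simp add: h_def algebra_simps flip: exp_add)
      moreover have "(\<i> * of_real (h * x)) ^ k /\<^sub>R fact k * iexp (u * x) = ?g k x" for k
        by (simp add: scaleR_conv_of_real divide_inverse power_mult_distrib mult_ac)
      ultimately show ?thesis by (simp only:)
    qed
    have "(\<lambda>k. integral\<^sup>L M (?g k)) sums (\<integral>x. (\<Sum>k. ?g k x) \<partial>M)"
    proof (rule sums_integral)
      show "integrable M (?g k)" for k by (intro integrable_mult_right term_int)
      show "AE x in M. summable (\<lambda>k. norm (?g k x))"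
      proof (rule AE_I2)
        fix x
        have "summable (\<lambda>k. (\<bar>h\<bar> * \<bar>x\<bar>) ^ k /\<^sub>R fact k)" using exp_converges sums_summable by blast
        then show "summable (\<lambda>k. norm (?g k x))"
          unfolding norm_g by (simp add: power_mult_distrib divide_inverse mult_ac)
      qed
      have "\<bar>h\<bar> < 1" using t by (simp add: h_def)
      show "summable (\<lambda>k. \<integral>x. norm (?g k x) \<partial>M)"
      proof (rule summable_comparison_test'[OF maj[OF _ \<open>\<bar>h\<bar> < 1\<close>], of 0])
        fix k
        have "norm (\<integral>x. norm (?g k x) \<partial>M) = (\<integral>x. norm (?g k x) \<partial>M)"
          by (simp add: integral_nonneg_AE)
        also have "\<dots> = \<bar>h\<bar> ^ k * (expectation (\<lambda>x. \<bar>x\<bar> ^ k) / fact k)"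
          unfolding norm_g by simp
        also have "\<dots> \<le> \<bar>h\<bar> ^ k * (C * (real k + 2))"
          by (intro mult_left_mono absolute_moment_bound[OF int bd]) auto
        finally show "norm (\<integral>x. norm (?g k x) \<partial>M) \<le> C * (real k + 2) * \<bar>h\<bar> ^ k"
          by (simp only: mult_ac)
      qed simp
    qed
    also have "(\<lambda>x. \<Sum>k. ?g k x) = (\<lambda>x. iexp (t * x))"
      using g_sums by (simp only: sums_iff)
    also have "(\<lambda>k. integral\<^sup>L M (?g k)) = (\<lambda>k. \<alpha> k * (of_real t - of_real u) ^ k)"
      unfolding integral_mult_right_zero \<alpha>_def h_def power_mult_distrib of_real_diff
      by (simp only: times_divide_eq_left times_divide_eq_right mult_ac)
    finally show ?thesis unfolding F_def char_def by (rule sums_unique[symmetric])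
  qed
  ultimately show ?thesis by (rule that)
qed

text \<open>
  The interval of agreement is lengthened by \<open>1/2\<close> at each end in every step. Since the local
  extensions all have radius 1, one whose centre lies in the current interval reaches the new points,
  and the identity theorem applies on its disk.
\<close>

lemma char_eq_of_germ:
  assumes int: "\<And>k. integrable M (\<lambda>x. x ^ k)"
    and bd: "\<And>k. \<bar>expectation (\<lambda>x. x ^ k) / fact k\<bar> \<le> C"
    and R: "R holomorphic_on {z. \<bar>Im z\<bar> < 1}"
    and \<rho>: "0 < \<rho>" and germ: "\<And>t. \<bar>t\<bar> < \<rho> \<Longrightarrow> R (of_real t) = char M t"
  shows "R (of_real t) = char M t"
proof -
  have step: "R (of_real t) = char M t" if "\<bar>t\<bar> < \<rho> + real n / 2" for n t
    using that
  proof (induction n arbitrary: t)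
    case 0
    then show ?case using germ by simp
  next
    case (Suc n)
    define s where "s = \<rho> + real n / 2"
    have "0 < s" using \<rho> by (simp add: s_def)
    \<comment> \<open>Shrinking \<open>t\<close> by this factor puts the centre inside the known interval, within \<open>1/2\<close> of \<open>t\<close>.\<close>
    define u where "u = t * s / (s + 1 / 2)"
    have t: "\<bar>t\<bar> < s + 1 / 2" using Suc.prems by (simp add: s_def add_divide_distrib)
    have u: "\<bar>u\<bar> < s"
      using t \<open>0 < s\<close> by (simp add: u_def abs_mult abs_divide pos_divide_less_eq mult.commute)
    have tu: "\<bar>t - u\<bar> < 1"
    proof -
      have "t - u = t * (1 / 2) / (s + 1 / 2)" using \<open>0 < s\<close> by (simp add: u_def field_simps)
      then show ?thesis using t \<open>0 < s\<close> by (simp add: abs_mult abs_divide pos_divide_less_eq)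
    qed
    from char_holomorphic_extension[OF int bd, of u] obtain F where
      F: "F holomorphic_on ball (of_real u) 1" "\<And>t. \<bar>t - u\<bar> < 1 \<Longrightarrow> F (of_real t) = char M t"
      by blast
    let ?T = "{x. \<bar>x\<bar> < s \<and> \<bar>x - u\<bar> < 1}"
    have sub: "ball (complex_of_real u) 1 \<subseteq> {z. \<bar>Im z\<bar> < 1}"
    proof
      fix z assume "z \<in> ball (complex_of_real u) 1"
      then have "norm (z - of_real u) < 1" by (simp add: dist_norm norm_minus_commute)
      then show "z \<in> {z. \<bar>Im z\<bar> < 1}" using abs_Im_le_cmod[of "z - of_real u"] by simp
    qed
    have "R (of_real t) - F (of_real t) = 0"
    proof (rule analytic_continuation[of "\<lambda>z. R z - F z" "ball (of_real u) 1" "of_real ` ?T" "of_real u"])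
      show "(\<lambda>z. R z - F z) holomorphic_on ball (of_real u) 1"
        using R F(1) sub by (intro holomorphic_intros holomorphic_on_subset[OF R])
      show "complex_of_real ` ?T \<subseteq> ball (of_real u) 1"
        by (auto simp: dist_real_def abs_minus_commute)
      have "open ?T"
        by (intro open_Collect_conj open_Collect_less continuous_intros)
      then have "u islimpt ?T"
        using u by (intro interior_limit_point) (simp add: interior_open)
      then show "of_real u islimpt complex_of_real ` ?T"
        by (force simp: islimpt_approachable)
      show "R z - F z = 0" if "z \<in> of_real ` ?T" for z
        using that Suc.IH F(2) by (auto simp: s_def)
      show "complex_of_real t \<in> ball (of_real u) 1"
        using tu by (simp add: dist_real_def abs_minus_commute)
    qed simp_all
    then show ?case using F(2)[OF tu] by simp
  qed
  obtain n where "\<bar>t\<bar> * 2 < real n" using reals_Archimedean2 by blast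
  then show ?thesis using \<rho> by (intro step[of _ n]) simp
qed

text \<open>
  To see the sign of the limit, take \<open>N\<close> points spaced by
  \<open>s\<close>: positive definiteness gives \<open>0 \<le> \<Sum>\<^sub>j\<^sub>,\<^sub>l Re \<phi> ((j - l) s)\<close> for the characteristic function
  \<open>\<phi>\<close>, and as \<open>s\<close> grows the sum tends to \<open>N + N (N - 1) b\<close>. For negative \<open>b\<close> and large \<open>N\<close> this is negative.
\<close>

lemma char_limit_at_infinity_nonneg:
  assumes lim: "((\<lambda>t. Re (char M t)) \<longlongrightarrow> b) at_infinity"
  shows "0 \<le> b"
proof (rule ccontr)
  assume "\<not> 0 \<le> b"
  \<comment> \<open>The double sum is the integral of the squared modulus of \<open>\<Sum>\<^sub>j exp (i j s x)\<close>.\<close>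
  have fejer: "0 \<le> (\<Sum>j<N. \<Sum>l<N. Re (char M ((real j - real l) * s)))" for N :: nat and s :: real
  proof -
    have int: "integrable M (\<lambda>x. cos (v * x))" for v
      by (rule integrable_const_bound[of _ 1]) auto
    have Re_char: "Re (char M v) = expectation (\<lambda>x. cos (v * x))" for v
    proof -
      have "complex_integrable M (\<lambda>x. iexp (v * x))" by (intro integrable_iexp) auto
      then show ?thesis unfolding char_def by (simp add: Re_exp flip: integral_Re)
    qed
    have "0 \<le> expectation (\<lambda>x. (\<Sum>j<N. cos (real j * s * x))\<^sup>2 + (\<Sum>j<N. sin (real j * s * x))\<^sup>2)"
      by (rule integral_nonneg_AE) simp
    also have "(\<lambda>x. (\<Sum>j<N. cos (real j * s * x))\<^sup>2 + (\<Sum>j<N. sin (real j * s * x))\<^sup>2)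
        = (\<lambda>x. \<Sum>j<N. \<Sum>l<N. cos ((real j - real l) * s * x))"
      by (simp add: power2_eq_square sum_product cos_diff left_diff_distrib flip: sum.distrib)
    also have "expectation \<dots> = (\<Sum>j<N. \<Sum>l<N. Re (char M ((real j - real l) * s)))"
      by (simp add: Re_char int)
    finally show ?thesis .
  qed
  have nonneg: "0 \<le> (\<Sum>j<N. \<Sum>l<N. if j = l then 1 else b)" for N :: nat
  proof (rule tendsto_lowerbound)
    show "((\<lambda>s. \<Sum>j<N. \<Sum>l<N. Re (char M ((real j - real l) * s)))
        \<longlongrightarrow> (\<Sum>j<N. \<Sum>l<N. if j = l then 1 else b)) at_top"
    proof (intro tendsto_sum)
      fix j l
      show "((\<lambda>s. Re (char M ((real j - real l) * s))) \<longlongrightarrow> (if j = l then 1 else b)) at_top"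
      proof (cases "j = l")
        case False
        then have "filterlim (\<lambda>s. (real j - real l) * s) at_infinity at_top"
          by (intro tendsto_mult_filterlim_at_infinity[OF tendsto_const])
            (auto intro: filterlim_mono[OF filterlim_ident at_top_le_at_infinity])
        with lim False show ?thesis by (auto intro: filterlim_compose)
      qed (simp add: char_zero)
    qed
  qed (use fejer in auto)
  have inner: "(\<Sum>l<N. if j = l then 1 else b) = 1 + (real N - 1) * b" if "j < N" for j N :: nat
  proof -
    have "(\<Sum>l<N. if j = l then 1 else b) = (\<Sum>l<N. b + (if j = l then 1 - b else 0))"
      by (intro sum.cong) auto
    also have "\<dots> = 1 + (real N - 1) * b"
      using that by (simp add: sum.distrib algebra_simps)
    finally show ?thesis .
  qed
  have eq: "0 \<le> real N * (1 + (real N - 1) * b)" for N :: nat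
    using nonneg[of N] by (simp add: inner)
  obtain N where N: "1 / - b + 1 < real N" using reals_Archimedean2 by blast
  have "0 < 1 / - b" using \<open>\<not> 0 \<le> b\<close> by simp
  then have "0 < real N" using N by linarith
  moreover have "1 + (real N - 1) * b < 0"
  proof -
    have "1 / - b < real N - 1" using N by simp
    then show ?thesis using \<open>\<not> 0 \<le> b\<close> by (simp add: field_simps)
  qed
  ultimately show False using eq[of N] by (simp add: zero_le_mult_iff)
qed

end

section \<open>Exponential mixtures and the characterization\<close>

text \<open>
  For weights \<open>b, p, q \<ge> 0\<close> of sum 1 this is the characteristic function of a mixture of the point
  mass at 0, the standard exponential law and its reflection. The argument is complex because the
  function is used in the strip \<open>\<bar>Im z\<bar> < 1\<close>, which contains no pole.
\<close>

definition exp_mixture_char :: "complex \<Rightarrow> complex \<Rightarrow> complex \<Rightarrow> complex \<Rightarrow> complex" where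
  "exp_mixture_char b p q z = b + p / (1 - \<i> * z) + q / (1 + \<i> * z)"

lemma exp_mixture_denominators_nonzero:
  assumes "\<bar>Im z\<bar> < 1"
  shows "1 - \<i> * z \<noteq> 0" "1 + \<i> * z \<noteq> 0"
  using assms by (auto simp: complex_eq_iff)

lemma exp_mixture_char_sums:
  assumes z: "norm z < 1"
  shows "(\<lambda>k. ((if k = 0 then b else 0) + \<i> ^ k * (p + (-1) ^ k * q)) * z ^ k) sums exp_mixture_char b p q z"
proof -
  have "(\<lambda>k. if k = 0 then b else 0) sums b" using sums_single[of 0 "\<lambda>_. b"] by simp
  moreover have "(\<lambda>k. p * (\<i> * z) ^ k) sums (p * (1 / (1 - \<i> * z)))"
    using z by (intro sums_mult geometric_sums) (simp add: norm_mult)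
  moreover have "(\<lambda>k. q * (- (\<i> * z)) ^ k) sums (q * (1 / (1 - (- (\<i> * z)))))"
    using z by (intro sums_mult geometric_sums) (simp add: norm_mult)
  ultimately have "(\<lambda>k. (if k = 0 then b else 0) + p * (\<i> * z) ^ k + q * (- (\<i> * z)) ^ k)
      sums (b + p * (1 / (1 - \<i> * z)) + q * (1 / (1 - (- (\<i> * z)))))"
    by (intro sums_add)
  moreover have "(if k = 0 then b else 0) + p * (\<i> * z) ^ k + q * (- (\<i> * z)) ^ k
      = ((if k = 0 then b else 0) + \<i> ^ k * (p + (-1) ^ k * q)) * z ^ k" for k
    by (cases "k = 0") (simp_all add: power_mult_distrib algebra_simps power_minus[of "\<i> * z"])
  ultimately show ?thesis by (simp add: exp_mixture_char_def)
qed

lemma exp_mixture_char_of_real: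
  fixes a b t :: real
  shows "exp_mixture_char b ((1 + a - b) / 2) ((1 - a - b) / 2) t
    = (1 + \<i> * of_real a * of_real t + of_real b * of_real t ^ 2) / (1 + of_real t ^ 2)"
proof -
  have nz: "1 - \<i> * complex_of_real t \<noteq> 0" "1 + \<i> * complex_of_real t \<noteq> 0"
    by (auto simp: complex_eq_iff)
  have "c + p / x + q / y = (c * (x * y) + p * y + q * x) / (x * y)"
    if "x \<noteq> 0" "y \<noteq> 0" for c p q x y :: complex
    using that by (simp add: add_divide_distrib)
  note common_denominator = this[OF nz]
  have "(1 - \<i> * t) * (1 + \<i> * t) = 1 + (complex_of_real t)\<^sup>2"
    by (simp add: algebra_simps power2_eq_square)
  moreover have "complex_of_real b * ((1 - \<i> * t) * (1 + \<i> * t))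
      + complex_of_real ((1 + a - b) / 2) * (1 + \<i> * t) + complex_of_real ((1 - a - b) / 2) * (1 - \<i> * t)
      = 1 + \<i> * of_real a * of_real t + of_real b * of_real t ^ 2"
    by (simp add: complex_eq_iff power2_eq_square field_simps)
  ultimately show ?thesis
    unfolding exp_mixture_char_def common_denominator by simp
qed

text \<open>
  The first two families are those members of the third one in which one of the two exponential
  parts has weight 0: put \<open>b = a\<close> and replace \<open>a\<close> by \<open>a - 1\<close> or \<open>1 - a\<close>.
\<close>

lemma listed_form_exp_mixture:
  assumes "has_listed_form f"
  obtains a b :: real where "\<And>t. f t = exp_mixture_char b ((1 + a - b) / 2) ((1 - a - b) / 2) t"
proof -
  have nz: "1 - \<i> * complex_of_real t \<noteq> 0" "1 + \<i> * complex_of_real t \<noteq> 0" for t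
    by (auto simp: complex_eq_iff)
  from assms consider
    (pos) a where "\<forall>t. f t = (1 + \<i> * of_real a * of_real t) / (1 + \<i> * of_real t)"
  | (neg) a where "\<forall>t. f t = (1 - \<i> * of_real a * of_real t) / (1 - \<i> * of_real t)"
  | (both) a b where "\<forall>t. f t = (1 + \<i> * of_real a * of_real t + of_real b * of_real t ^ 2) / (1 + of_real t ^ 2)"
    unfolding has_listed_form_def by blast
  then show ?thesis
  proof cases
    case pos
    have "f t = a + (1 - a) / (1 + \<i> * t)" for t
    proof -
      have "1 + \<i> * complex_of_real a * complex_of_real t = a * (1 + \<i> * t) + (1 - a)"
        by (simp add: algebra_simps)
      then have "f t = (a * (1 + \<i> * t) + (1 - a)) / (1 + \<i> * t)"
        using pos[rule_format, of t] by (simp only:)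
      then show ?thesis using nz[of t] by (simp add: add_divide_distrib)
    qed
    moreover have "(1 + (a - 1) - a) / 2 = 0" "(1 - (a - 1) - a) / 2 = 1 - a" by simp_all
    ultimately show ?thesis by (intro that[of a "a - 1"]) (simp only: exp_mixture_char_def, simp)
  next
    case neg
    have "f t = a + (1 - a) / (1 - \<i> * t)" for t
    proof -
      have "1 - \<i> * complex_of_real a * complex_of_real t = a * (1 - \<i> * t) + (1 - a)"
        by (simp add: algebra_simps)
      then have "f t = (a * (1 - \<i> * t) + (1 - a)) / (1 - \<i> * t)"
        using neg[rule_format, of t] by (simp only:)
      then show ?thesis using nz[of t] by (simp add: add_divide_distrib)
    qed
    moreover have "(1 + (1 - a) - a) / 2 = 1 - a" "(1 - (1 - a) - a) / 2 = 0" by simp_all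
    ultimately show ?thesis by (intro that[of a "1 - a"]) (simp only: exp_mixture_char_def, simp)
  next
    case both
    then show ?thesis using that[of b a] by (simp only: exp_mixture_char_of_real)
  qed
qed

context real_distribution
begin

text \<open>
  Subtracting the eventual pattern from the moment ratios leaves finitely many terms, which form the
  polynomial \<open>P\<close>; the rest is summed as two geometric series. After continuation, boundedness
  reduces \<open>P\<close> to a constant, whose value \<open>1 - p - q\<close> comes from \<open>t = 0\<close>.
\<close>

lemma char_listed_of_finite_moment_ratios:
  defines "m \<equiv> \<lambda>k. expectation (\<lambda>x. x ^ k) / fact k"
  assumes r: "0 < r" and an: "analytic_in_disk (char M) r c"
    and nz: "\<not> (AE x in M. x = 0)" and fin: "finite (range m)"
  shows "has_listed_form (char M)"
proof -
  note int = moments_of_analytic_char(1)[OF r an]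
  have coeff: "c k = \<i> ^ k * of_real (m k)" for k
    unfolding m_def by (rule moments_of_analytic_char(2)[OF r an])
  have m_fold: "expectation (\<lambda>x. x ^ k) / fact k = m k" for k by (simp add: m_def)
  define C where "C = Max ((\<lambda>x. \<bar>x\<bar>) ` range m)"
  have bd: "\<bar>expectation (\<lambda>x. x ^ k) / fact k\<bar> \<le> C" for k
    unfolding m_fold C_def using fin by (intro Max_ge) auto
  obtain p q where pq: "0 \<le> p" "0 \<le> q" and ev: "eventually (\<lambda>k. m k = p + (-1) ^ k * q) sequentially"
    using moment_ratios_eventually_periodic[OF int nz fin[unfolded m_def]] unfolding m_fold by blast
  then obtain K where K: "\<And>k. K \<le> k \<Longrightarrow> m k = p + (-1) ^ k * q"
    by (auto simp: eventually_sequentially)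
  define d where "d k = m k - (p + (-1) ^ k * q)" for k
  define P where "P = (\<Sum>k<K. monom (\<i> ^ k * complex_of_real (d k)) k)"
  define R where "R z = poly P z + exp_mixture_char 0 p q z" for z
  have R_sums: "(\<lambda>k. c k * z ^ k) sums R z" if "norm z < 1" for z
  proof -
    have "(\<lambda>k. if k \<in> {..<K} then \<i> ^ k * complex_of_real (d k) * z ^ k else 0)
        sums (\<Sum>k<K. \<i> ^ k * complex_of_real (d k) * z ^ k)"
      by (rule sums_If_finite_set) simp
    moreover have "(\<Sum>k<K. \<i> ^ k * complex_of_real (d k) * z ^ k) = poly P z"
      by (simp add: P_def poly_sum poly_monom)
    ultimately have "(\<lambda>k. (if k \<in> {..<K} then \<i> ^ k * complex_of_real (d k) * z ^ k else 0)
        + ((if k = 0 then 0 else 0) + \<i> ^ k * (of_real p + (-1) ^ k * of_real q)) * z ^ k) sums R z"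
      unfolding R_def by (intro sums_add exp_mixture_char_sums that) simp
    moreover have "(if k \<in> {..<K} then \<i> ^ k * complex_of_real (d k) * z ^ k else 0)
        + ((if k = 0 then 0 else 0) + \<i> ^ k * (of_real p + (-1) ^ k * of_real q)) * z ^ k
        = c k * z ^ k" for k
      using K[of k] by (cases "k < K") (simp_all add: coeff d_def algebra_simps)
    ultimately show ?thesis by simp
  qed
  have char_R: "R (of_real t) = char M t" for t
  proof (rule char_eq_of_germ[OF int bd])
    show "R holomorphic_on {z. \<bar>Im z\<bar> < 1}"
      unfolding R_def exp_mixture_char_def
      by (intro holomorphic_intros) (auto dest: exp_mixture_denominators_nonzero)
    show "0 < min r 1" using r by simp
    fix t :: real assume t: "\<bar>t\<bar> < min r 1"
    from an obtain F where F: "\<forall>z\<in>ball 0 r. (\<lambda>k. c k * z ^ k) sums F z"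
      "\<forall>t. \<bar>t\<bar> < r \<longrightarrow> F (of_real t) = char M t"
      unfolding analytic_in_disk_def by blast
    have "(\<lambda>k. c k * of_real t ^ k) sums F (of_real t)" using F(1) t by simp
    moreover have "(\<lambda>k. c k * of_real t ^ k) sums R (of_real t)" using R_sums t by simp
    ultimately have "R (of_real t) = F (of_real t)" by (rule sums_unique2[symmetric])
    then show "R (of_real t) = char M t" using F(2) t by simp
  qed
  have norm_ge_1: "1 \<le> norm (1 - \<i> * complex_of_real t)" "1 \<le> norm (1 + \<i> * complex_of_real t)" for t
    using complex_Re_le_cmod[of "1 - \<i> * complex_of_real t"]
      complex_Re_le_cmod[of "1 + \<i> * complex_of_real t"] by simp_all
  have mixture_bound: "norm (of_real p / (1 - \<i> * of_real t)) \<le> p"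
      "norm (of_real q / (1 + \<i> * of_real t)) \<le> q" for t
  proof -
    have "x / n \<le> x" if "0 \<le> x" "1 \<le> n" for x n :: real
      using mult_left_mono[of 1 n x] that by (simp add: divide_le_eq)
    then show "norm (of_real p / (1 - \<i> * of_real t)) \<le> p"
      "norm (of_real q / (1 + \<i> * of_real t)) \<le> q"
      using pq norm_ge_1[of t] by (simp_all only: norm_divide norm_of_real abs_of_nonneg)
  qed
  have "norm (poly P (of_real t)) \<le> 1 + p + q" for t
  proof -
    have "poly P (of_real t) = char M t - of_real p / (1 - \<i> * of_real t) - of_real q / (1 + \<i> * of_real t)"
      using char_R[of t] by (simp add: R_def exp_mixture_char_def algebra_simps)
    also have "norm \<dots> \<le> norm (char M t) + norm (of_real p / (1 - \<i> * of_real t))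
        + norm (of_real q / (1 + \<i> * of_real t))"
      by (intro order_trans[OF norm_triangle_ineq4] add_mono order_refl norm_triangle_ineq4)
    also have "\<dots> \<le> 1 + p + q"
      using cmod_char_le_1[of t] mixture_bound[of t] by simp
    finally show ?thesis .
  qed
  then obtain b0 where "P = [:b0:]" by (rule bounded_polynomial_on_reals_const)
  then have R_b0: "char M t = b0 + of_real p / (1 - \<i> * of_real t) + of_real q / (1 + \<i> * of_real t)" for t
    using char_R[of t] by (simp add: R_def exp_mixture_char_def add.assoc)
  define b where "b = 1 - p - q"
  have "b0 = of_real b"
    using R_b0[of 0] char_zero by (simp add: b_def algebra_simps)
  then have char_eq: "char M t = of_real b + of_real p / (1 - \<i> * of_real t) + of_real q / (1 + \<i> * of_real t)" for t
    using R_b0 by simp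
  have "0 \<le> b"
  proof (rule char_limit_at_infinity_nonneg)
    have norm_ge: "norm t \<le> norm (1 - \<i> * complex_of_real t)" "norm t \<le> norm (1 + \<i> * complex_of_real t)"
      for t :: real
      using abs_Im_le_cmod[of "1 - \<i> * complex_of_real t"]
        abs_Im_le_cmod[of "1 + \<i> * complex_of_real t"] by simp_all
    have inf: "filterlim (\<lambda>t. 1 - \<i> * complex_of_real t) at_infinity at_infinity"
      "filterlim (\<lambda>t. 1 + \<i> * complex_of_real t) at_infinity at_infinity"
      unfolding filterlim_at_infinity_conv_norm_at_top
      by (auto intro!: filterlim_at_top_mono[OF filterlim_norm_at_top] always_eventually norm_ge)
    have "(char M \<longlongrightarrow> of_real b + 0 + 0) at_infinity"
      unfolding char_eq[abs_def] by (intro tendsto_add tendsto_const tendsto_divide_0[OF tendsto_const] inf)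
    then show "((\<lambda>t. Re (char M t)) \<longlongrightarrow> b) at_infinity"
      by (auto dest: tendsto_Re)
  qed
  define a where "a = p - q"
  have p: "p = (1 + a - b) / 2" and q: "q = (1 - a - b) / 2"
    by (simp_all add: a_def b_def)
  have "char M t = (1 + \<i> * of_real a * of_real t + of_real b * of_real t ^ 2) / (1 + of_real t ^ 2)" for t
    unfolding exp_mixture_char_of_real[symmetric] p[symmetric] q[symmetric]
    unfolding char_eq exp_mixture_char_def ..
  with pq \<open>0 \<le> b\<close> show ?thesis
    unfolding has_listed_form_def p q by blast
qed

text \<open>
  The function is analytic in the unit disk with explicit coefficients, so the moments can be read off.
\<close>

lemma finite_moment_ratios_of_listed_char:
  assumes "has_listed_form (char M)"
  shows "integrable M (\<lambda>x. x ^ k)" and "finite (range (\<lambda>k. expectation (\<lambda>x. x ^ k) / fact k))"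
proof -
  from assms obtain a b :: real where
    form: "char M t = exp_mixture_char b ((1 + a - b) / 2) ((1 - a - b) / 2) t" for t
    by (rule listed_form_exp_mixture) blast
  define p q where "p = (1 + a - b) / 2" and "q = (1 - a - b) / 2"
  define c where "c k = (if k = 0 then complex_of_real b else 0) + \<i> ^ k * (of_real p + (-1) ^ k * of_real q)" for k
  have "analytic_in_disk (char M) 1 c"
    unfolding analytic_in_disk_def
  proof (intro exI[of _ "exp_mixture_char b p q"] conjI ballI allI impI)
    have "exp_mixture_char b p q holomorphic_on {z. \<bar>Im z\<bar> < 1}"
      unfolding exp_mixture_char_def[abs_def]
      by (intro holomorphic_intros) (auto dest: exp_mixture_denominators_nonzero)
    moreover have "ball 0 1 \<subseteq> {z. \<bar>Im z\<bar> < 1}"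
      using abs_Im_le_cmod by (fastforce intro: le_less_trans)
    ultimately show "exp_mixture_char b p q analytic_on ball 0 1"
      by (simp add: analytic_on_open holomorphic_on_subset)
    show "(\<lambda>k. c k * z ^ k) sums exp_mixture_char b p q z" if "z \<in> ball 0 1" for z
      unfolding c_def using that by (intro exp_mixture_char_sums) simp
    show "exp_mixture_char b p q (of_real t) = char M t" for t
      unfolding form p_def q_def ..
  qed
  note moments = moments_of_analytic_char[OF zero_less_one this]
  show "integrable M (\<lambda>x. x ^ k)" by (rule moments(1))
  have "expectation (\<lambda>x. x ^ k) / fact k \<in> {b + p + q, p + q, p - q}" for k
  proof -
    have "\<i> ^ k * of_real (expectation (\<lambda>x. x ^ k) / fact k)
        = \<i> ^ k * of_real ((if k = 0 then b else 0) + (p + (-1) ^ k * q))"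
      using moments(2)[of k] by (cases "k = 0") (simp_all add: c_def)
    then have "expectation (\<lambda>x. x ^ k) / fact k = (if k = 0 then b else 0) + (p + (-1) ^ k * q)"
      by (simp only: mult_cancel_left of_real_eq_iff) simp
    then show ?thesis by (cases "even k") auto
  qed
  then have "range (\<lambda>k. expectation (\<lambda>x. x ^ k) / fact k) \<subseteq> {b + p + q, p + q, p - q}" by blast
  then show "finite (range (\<lambda>k. expectation (\<lambda>x. x ^ k) / fact k))"
    by (rule finite_subset) simp
qed

end

theorem theorem2p1:
  fixes M :: "'a measure" and X :: "'a \<Rightarrow> real" and f :: "real \<Rightarrow> complex"
  assumes "prob_space M"
    and "X \<in> borel_measurable M"
    and "\<not> degenerate_rv M X"
    and "f = char_fun M X"
  shows "(\<forall>r c. r > 0 \<longrightarrow> analytic_in_disk f r c \<longrightarrow> finite (moment_ratios M X)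
            \<longrightarrow> has_listed_form f)
       \<and> (has_listed_form f
            \<longrightarrow> (\<forall>k. integrable M (\<lambda>x. X x ^ k)) \<and> finite (moment_ratios M X))"
proof -
  interpret prob_space M by fact
  note X [measurable] = assms(2)
  interpret law: real_distribution "distr M borel X" by simp
  have f: "f = char (distr M borel X)" using assms(4) by (simp add: char_fun_def)
  have "law.expectation (\<lambda>x. x ^ k) = moment M X k" for k
    unfolding moment_def by (subst integral_distr) auto
  then have ratios: "moment_ratios M X = range (\<lambda>k. law.expectation (\<lambda>x. x ^ k) / fact k)"
    by (auto simp: moment_ratios_def)
  have "\<not> (AE x in distr M borel X. x = 0)"
    using assms(3) by (subst AE_distr_iff) (auto simp: degenerate_rv_def)
  moreover have "integrable M (\<lambda>x. X x ^ k)" if "integrable (distr M borel X) (\<lambda>x. x ^ k)" for k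
    using that by (subst (asm) integrable_distr_eq) auto
  ultimately show ?thesis
    unfolding f ratios
    using law.char_listed_of_finite_moment_ratios law.finite_moment_ratios_of_listed_char by blast
qed

end
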